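(* Let $1\leq k<n$ be integers and let $f\in\mathcal{F}_n$. Then $$\int_{G_{n,k}}\pi_E(f)(0)^n\,d\mu_{n,k}(E)\leq\int_{G_{n,k}}\pi_E(\mathbf{1}_{Q_n})(0)^n\,d\mu_{n,k}(E).$$
   Context: $G_{n,k}$ is the Grassmannian of all $k$-dimensional linear subspaces of $\mathbb{R}^n$, and $\mu_{n,k}$ is the Haar (rotation-invariant) probability measure on $G_{n,k}$. $Q_n=[-1/2,1/2]^n$ is the unit cube and $\mathbf{1}_{Q_n}$ its indicator function. The class $\mathcal{F}_n$ consists of all functions on $\mathbb{R}^n$ of the form $f(x)=\prod_{i=1}^n f_i(x_i)$, where each $f_i:\mathbb{R}\to[0,\infty)$ is a probability density with $\|f_i\|_{L^\infty(\mathbb{R})}\leq 1=\|f_i\|_{L^1(\mathbb{R})}$, $i=1,\ldots,n$. For a probability density $f$ on $\mathbb{R}^n$ and a subspace $E$, the marginal density of $f$ on $E$ is $$\pi_E(f)(x)=\int_{E^\perp+x}f(y)\,dy\quad(x\in E),$$ where $E^\perp$ is the orthogonal complement of $E$ and the integral is with respect to Lebesgue measure on the affine subspace $E^\perp+x$. *)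

theory Defs
  imports "HOL-Probability.Probability"
begin

text \<open>The ambient space is \<open>real ^ 'n\<close>, so that \<open>n = CARD('n)\<close>.\<close>

definition grassmannian :: "nat \<Rightarrow> (real ^ 'n) set set" where
  "grassmannian k = {E. subspace E \<and> dim E = k}"

text \<open>
  As usual, the Grassmannian is topologized by identifying a subspace \<open>E\<close> with the
  matrix of the orthogonal projection onto \<open>E\<close> (which maps \<open>x\<close> to the point of \<open>E\<close> closest
  to \<open>x\<close>). The following measure space carries the resulting Borel sigma-algebra; only its
  \<open>space\<close> and \<open>sets\<close> are meaningful.
\<close>

definition projection_matrix :: "(real ^ 'n) set \<Rightarrow> real ^ 'n ^ 'n" where
  "projection_matrix E = matrix (closest_point E)"

definition grassmannian_borel :: "nat \<Rightarrow> (real ^ 'n) set measure" where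
  "grassmannian_borel k = vimage_algebra (grassmannian k) projection_matrix borel"

text \<open>
  The rotation-invariant Borel probability measure on the Grassmannian, described by its
  characterizing property. For \<open>1 \<le> k < n\<close> the group of rotations acts transitively, so
  there is exactly one such measure, and it is invariant under all orthogonal maps.
\<close>

definition haar_grassmannian :: "nat \<Rightarrow> (real ^ 'n) set measure \<Rightarrow> bool" where
  "haar_grassmannian k \<mu> \<longleftrightarrow>
     prob_space \<mu> \<and> sets \<mu> = sets (grassmannian_borel k) \<and>
     (\<forall>R. rotation_matrix R \<longrightarrow> distr \<mu> \<mu> (\<lambda>E. (*v) R ` E) = \<mu>)"

definition orthonormal_basis_of :: "(real ^ 'n) set \<Rightarrow> (real ^ 'n) set \<Rightarrow> bool" where
  "orthonormal_basis_of V B \<longleftrightarrow>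
     B \<subseteq> V \<and> span B = V \<and> pairwise orthogonal B \<and> (\<forall>b\<in>B. norm b = 1)"

text \<open>
  Lebesgue measure on the affine subspace \<open>V + x\<close>, where \<open>V\<close> is a linear subspace, regarded
  as a measure on the whole space concentrated on \<open>V + x\<close>. It is transported from
  coordinates with respect to an orthonormal basis of \<open>V\<close>, in the same way as \<^const>\<open>lborel\<close>
  is obtained from the standard basis; the choice of the basis does not matter, since
  Lebesgue measure is invariant under orthogonal maps.
\<close>

definition affine_lebesgue :: "(real ^ 'n) set \<Rightarrow> real ^ 'n \<Rightarrow> (real ^ 'n) measure" where
  "affine_lebesgue V x =
     (let B = (SOME B. orthonormal_basis_of V B)
      in completion (distr (\<Pi>\<^sub>M b\<in>B. lborel) borel (\<lambda>c. (\<Sum>b\<in>B. c b *\<^sub>R b) + x)))"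

text \<open>
  The marginal density is \<^typ>\<open>ennreal\<close>-valued, because for exceptional \<open>E\<close> the integral may
  diverge.
\<close>

definition marginal_density :: "(real ^ 'n) set \<Rightarrow> (real ^ 'n \<Rightarrow> real) \<Rightarrow> real ^ 'n \<Rightarrow> ennreal" where
  "marginal_density E f x = (\<integral>\<^sup>+ y. ennreal (f y) \<partial>affine_lebesgue (E\<^sup>\<bottom>) x)"

text \<open>
  The two norm conditions are \<open>\<parallel>g\<parallel>\<^sub>\<infinity> \<le> 1\<close> and \<open>\<parallel>g\<parallel>\<^sub>1 = 1\<close>; since \<open>g \<ge> 0\<close>, no absolute values
  are needed.
\<close>

definition bounded_density :: "(real \<Rightarrow> real) \<Rightarrow> bool" where
  "bounded_density g \<longleftrightarrow>
     g \<in> borel_measurable lebesgue \<and> (\<forall>t. 0 \<le> g t) \<and>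
     esssup lebesgue (\<lambda>t. ennreal (g t)) \<le> 1 \<and>
     (\<integral>\<^sup>+ t. ennreal (g t) \<partial>lebesgue) = 1"

definition product_densities :: "(real ^ 'n \<Rightarrow> real) set" where
  "product_densities =
     {f. \<exists>g. (\<forall>i. bounded_density (g i)) \<and> f = (\<lambda>x. \<Prod>i\<in>UNIV. g i (x $ i))}"

definition centered_unit_cube :: "(real ^ 'n) set" where
  "centered_unit_cube = {x. \<forall>i. x $ i \<in> {-1/2..1/2}}"

end

(*
  The inequality holds pointwise: pi_E(f)(0) <= pi_E(1_Q)(0) for every E that contains no
  coordinate vector, and the remaining E form a null set. In coordinates of the orthogonal
  complement, both sides are integrals of a product of functions of one linear form each, and this
  functional is multilinear. By a bathtub argument, one density at a time is replaced by a finite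
  union of intervals of total length at most 1. As in the proof of the
  Rogers-Brascamp-Lieb-Luttinger inequality, all these intervals are then slid towards the origin
  and merged when they touch, which increases the functional by the Prekopa-Leindler inequality,
  until each union has become one centred interval of length at most 1.
*)
theory Submission
  imports Defs "HOL-Computational_Algebra.Polynomial"
begin

section \<open>Brunn-Minkowski and Prekopa-Leindler\<close>

text \<open>No optimal union of intervals is claimed to exist. Each replacement of a density only
  keeps the functional above a prescribed \<open>c\<close> below its old value, and
  \<open>dense_le\<close> closes the gap. The bathtub set is merely measurable: it is shrunk to a
  compact set and then covered by cells of a fine grid, which costs length. The spare length comes
  from multiplying all densities by \<theta> < 1 beforehand; \<theta> tends to 1 at the very end.
  Sliding rests on the log-concavity of the volume of an intersection of slabs, as a function of all
  their centres jointly, and on its evenness. It therefore compares centres \<open>c\<close> only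
  with \<open>l * c\<close> for one common factor \<open>l\<close>, so the unions belonging to
  different forms cannot be treated one after the other: all of them move at once, and the next
  merger takes place wherever contact comes first.\<close>

lemma lborel_inner_compact:
  fixes S :: "real set"
  assumes [measurable]: "S \<in> sets borel" and "c < emeasure lborel S"
  obtains K where "compact K" "K \<subseteq> S" "c < emeasure lborel K"
proof -
  have ex: "\<exists>n. x \<in> {-real n..real n}" for x :: real
  proof -
    obtain n where "\<bar>x\<bar> \<le> real n" using real_arch_simple[of "\<bar>x\<bar>"] ..
    then show ?thesis by (intro exI[of _ n]) (simp add: abs_le_iff)
  qed
  have "(\<Union>n. S \<inter> {-real n..real n}) = S"
    using ex by blast
  moreover have "(SUP n. emeasure lborel (S \<inter> {-real n..real n})) = emeasure lborel (\<Union>n. S \<inter> {-real n..real n})"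
    by (intro SUP_emeasure_incseq) (auto simp: incseq_def)
  ultimately have "c < (SUP n. emeasure lborel (S \<inter> {-real n..real n}))"
    using assms(2) by simp
  then obtain n where n: "c < emeasure lborel (S \<inter> {-real n..real n})"
    unfolding less_SUP_iff by blast
  \<comment> \<open>\<open>inner_regular\<close> is about finite measures, so Lebesgue measure is
    restricted to a bounded interval that still sees more than \<open>c\<close> of
    \<open>S\<close>.\<close>
  define M where "M = density lborel (indicator {-real n..real n} :: real \<Rightarrow> ennreal)"
  have M: "emeasure M A = emeasure lborel (A \<inter> {-real n..real n})" if "A \<in> sets borel" for A
  proof -
    have "(\<lambda>x. indicator {-real n..real n} x * indicator A x) = (indicator (A \<inter> {-real n..real n}) :: real \<Rightarrow> ennreal)"
      by (auto simp: indicator_def fun_eq_iff)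
    then show ?thesis using that by (simp add: M_def emeasure_density)
  qed
  have "emeasure M S = (SUP K\<in>{K. K \<subseteq> S \<and> compact K}. emeasure M K)"
  proof (rule inner_regular)
    show "sets M = sets borel" by (simp add: M_def)
    show "emeasure M (space M) \<noteq> \<infinity>" by (simp add: M_def emeasure_density)
  qed simp
  with n have "c < (SUP K\<in>{K. K \<subseteq> S \<and> compact K}. emeasure M K)" by (simp add: M)
  then obtain K where K: "K \<subseteq> S" "compact K" "c < emeasure M K"
    unfolding less_SUP_iff by blast
  have "emeasure M K \<le> emeasure lborel K"
    using K by (subst M) (auto simp: borel_compact intro!: emeasure_mono)
  with K show thesis by (intro that[of K]) auto
qed

lemma emeasure_lborel_affine_image:
  fixes S :: "real set"
  assumes "S \<in> sets borel" "c \<noteq> 0"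
  shows "emeasure lborel ((\<lambda>x. d + c * x) ` S) = ennreal \<bar>c\<bar> * emeasure lborel S"
    and "(\<lambda>x. d + c * x) ` S \<in> sets borel"
proof -
  have eq: "(\<lambda>x. d + c * x) ` S = (\<lambda>y. (y - d) / c) -` S"
    using assms(2) by (auto simp: image_iff field_simps intro!: bexI[of _ "(_ - d) / c"])
  show *: "(\<lambda>x. d + c * x) ` S \<in> sets borel"
    unfolding eq using assms(1) measurable_sets_borel[of "\<lambda>y. (y - d) / c" borel S] by simp
  have "emeasure lborel ((\<lambda>x. d + c * x) ` S) = (\<integral>\<^sup>+x. indicator ((\<lambda>x. d + c * x) ` S) x \<partial>lborel)"
    using * by simp
  also have "\<dots> = ennreal \<bar>c\<bar> * (\<integral>\<^sup>+x. indicator ((\<lambda>x. d + c * x) ` S) (d + c * x) \<partial>lborel)"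
    using * assms(2) by (intro nn_integral_real_affine) auto
  also have "(\<lambda>x. indicator ((\<lambda>x. d + c * x) ` S) (d + c * x) :: ennreal) = indicator S"
    using assms(2) by (auto simp: indicator_def image_iff fun_eq_iff)
  finally show "emeasure lborel ((\<lambda>x. d + c * x) ` S) = ennreal \<bar>c\<bar> * emeasure lborel S"
    using assms(1) by simp
qed

text \<open>The translates of \<open>A\<close> by the least element of \<open>B\<close> and of \<open>B\<close> by the greatest
  element of \<open>A\<close> lie in the sumset and meet in a single point.\<close>

lemma brunn_minkowski_compact_real:
  fixes A B C :: "real set"
  assumes "compact A" "A \<noteq> {}" "compact B" "B \<noteq> {}" and C: "C \<in> sets borel"
    and sum: "\<And>a b. a \<in> A \<Longrightarrow> b \<in> B \<Longrightarrow> a + b \<in> C"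
  shows "emeasure lborel A + emeasure lborel B \<le> emeasure lborel C"
proof -
  obtain a where a: "a \<in> A" "\<And>x. x \<in> A \<Longrightarrow> x \<le> a"
    using compact_attains_sup[OF assms(1,2)] by blast
  obtain b where b: "b \<in> B" "\<And>x. x \<in> B \<Longrightarrow> b \<le> x"
    using compact_attains_inf[OF assms(3,4)] by blast
  have bor: "A \<in> sets borel" "B \<in> sets borel" using assms by (auto intro: borel_compact)
  let ?A = "(\<lambda>x. b + 1 * x) ` A" and ?B = "(\<lambda>x. a + 1 * x) ` B"
  note A = emeasure_lborel_affine_image[OF bor(1), of 1 b]
  note B = emeasure_lborel_affine_image[OF bor(2), of 1 a]
  have "emeasure lborel A + emeasure lborel B = emeasure lborel ?A + emeasure lborel ?B"
    using A B by simp
  also have "emeasure lborel ?B = emeasure lborel (?B - {a + b})"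
    using B(2) by (subst emeasure_Diff_null_set) (auto simp: null_sets_def)
  also have "emeasure lborel ?A + emeasure lborel (?B - {a + b}) = emeasure lborel (?A \<union> (?B - {a + b}))"
  proof (rule plus_emeasure)
    show "?A \<inter> (?B - {a + b}) = {}" using a(2) b(2) by (force simp: add.commute)
  qed (use A(2) B(2) in auto)
  also have "\<dots> \<le> emeasure lborel C"
    using sum[OF _ b(1)] sum[OF a(1)] C by (intro emeasure_mono) (auto simp: add.commute)
  finally show ?thesis .
qed

text \<open>The compact sets are required to be nonempty because Brunn-Minkowski fails for the empty
  set, whose sum with any set is empty.\<close>

lemma emeasure_lborel_eq_SUP_compact:
  fixes S :: "real set"
  assumes "S \<in> sets borel" "S \<noteq> {}"
  shows "emeasure lborel S = (SUP K\<in>{K. compact K \<and> K \<noteq> {} \<and> K \<subseteq> S}. emeasure lborel K)" (is "_ = Sup (_ ` ?I)")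
proof (rule antisym)
  show "emeasure lborel S \<le> (SUP K\<in>?I. emeasure lborel K)"
  proof (rule dense_le)
    fix c assume "c < emeasure lborel S"
    then obtain K where K: "compact K" "K \<subseteq> S" "c < emeasure lborel K"
      using lborel_inner_compact assms by metis
    then have "K \<noteq> {}" by auto
    with K have "emeasure lborel K \<le> (SUP K\<in>?I. emeasure lborel K)" by (intro SUP_upper) auto
    with K show "c \<le> (SUP K\<in>?I. emeasure lborel K)" by auto
  qed
  show "(SUP K\<in>?I. emeasure lborel K) \<le> emeasure lborel S"
    using assms by (intro SUP_least emeasure_mono) auto
qed

text \<open>A combination of Borel sets need not be Borel, hence the arbitrary Borel superset
  \<open>C\<close>. The compact case applies to the scaled copies of nonempty compact
  \<open>K\<close> and \<open>L\<close>, and the left side passes to the supremum over both.\<close>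

lemma brunn_minkowski_real:
  fixes S T C :: "real set"
  assumes S: "S \<in> sets borel" "S \<noteq> {}" and T: "T \<in> sets borel" "T \<noteq> {}" and C: "C \<in> sets borel"
    and t: "0 < t" "t < 1"
    and sum: "\<And>a b. a \<in> S \<Longrightarrow> b \<in> T \<Longrightarrow> (1 - t) * a + t * b \<in> C"
  shows "ennreal (1 - t) * emeasure lborel S + ennreal t * emeasure lborel T \<le> emeasure lborel C"
proof -
  let ?I = "\<lambda>S::real set. {K. compact K \<and> K \<noteq> {} \<and> K \<subseteq> S}"
  have ne: "?I S \<noteq> {}" "?I T \<noteq> {}" 
  proof -
    obtain a b where "a \<in> S" "b \<in> T" using S(2) T(2) by blast
    then have "{a} \<in> ?I S" "{b} \<in> ?I T" by simp_all
    then show "?I S \<noteq> {}" "?I T \<noteq> {}" by (auto simp only: empty_iff)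
  qed
  have "ennreal (1 - t) * emeasure lborel K + ennreal t * emeasure lborel L \<le> emeasure lborel C"
    if "K \<in> ?I S" "L \<in> ?I T" for K L
  proof -
    have "compact K" "compact L" using that by auto
    then have bor: "K \<in> sets borel" "L \<in> sets borel" by (auto intro: borel_compact)
    have "emeasure lborel ((\<lambda>x. 0 + (1 - t) * x) ` K) + emeasure lborel ((\<lambda>x. 0 + t * x) ` L)
        \<le> emeasure lborel C"
      using that t C sum
      by (intro brunn_minkowski_compact_real compact_continuous_image continuous_intros) auto
    then show ?thesis
      using emeasure_lborel_affine_image(1)[OF bor(1), of "1 - t" 0]
        emeasure_lborel_affine_image(1)[OF bor(2), of t 0] t by simp
  qed
  note * = this
  have eq: "ennreal (1 - t) * emeasure lborel S + ennreal t * emeasure lborel T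
     = (SUP K\<in>?I S. ennreal (1 - t) * emeasure lborel K) + (SUP L\<in>?I T. ennreal t * emeasure lborel L)"
    by (simp only: emeasure_lborel_eq_SUP_compact[OF S] emeasure_lborel_eq_SUP_compact[OF T] SUP_mult_left_ennreal)
  show ?thesis
    unfolding eq ennreal_SUP_add_left[OF ne(1), symmetric] ennreal_SUP_add_right[OF ne(2)]
    by (intro SUP_least *)
qed

section \<open>The Prekopa-Leindler inequality on the line\<close>

lemma layer_cake_le_one:
  assumes "sigma_finite_measure M" and [measurable]: "f \<in> borel_measurable M" and le: "\<And>x. f x \<le> 1"
  shows "(\<integral>\<^sup>+x. f x \<partial>M) = (\<integral>\<^sup>+u\<in>{0<..<1}. emeasure M {x\<in>space M. ennreal u < f x} \<partial>lborel)"
proof -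
  interpret M: sigma_finite_measure M by fact
  interpret P: pair_sigma_finite M "lborel :: real measure" ..
  \<comment> \<open>For fixed \<open>x\<close> the heights below \<open>f x\<close> form an interval
    of length \<open>f x\<close>, which the bound 1 keeps inside the unit interval; Fubini then
    integrates over \<open>x\<close> first.\<close>
  have "(\<integral>\<^sup>+u. indicator {u. ennreal u < f x} u * indicator {0<..<1} u \<partial>lborel) = f x" for x
  proof -
    obtain r where r: "f x = ennreal r" "0 \<le> r" "r \<le> 1"
      using le[of x] by (cases "f x") (auto simp: top_unique)
    have "(\<lambda>u. indicator {u. ennreal u < f x} u * indicator {0<..<1} u) = (indicator {0<..<r} :: real \<Rightarrow> ennreal)"
      using r by (auto simp: indicator_def fun_eq_iff ennreal_less_iff)
    then show ?thesis using r by simp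
  qed
  then have "(\<integral>\<^sup>+x. f x \<partial>M) = (\<integral>\<^sup>+x. \<integral>\<^sup>+u. indicator {u. ennreal u < f x} u * indicator {0<..<1} u \<partial>lborel \<partial>M)"
    by simp
  also have "\<dots> = (\<integral>\<^sup>+u. \<integral>\<^sup>+x. indicator {u. ennreal u < f x} u * indicator {0<..<1} u \<partial>M \<partial>lborel)"
    by (intro P.Fubini'[symmetric]) measurable
  also have "\<dots> = (\<integral>\<^sup>+u\<in>{0<..<1}. emeasure M {x\<in>space M. ennreal u < f x} \<partial>lborel)"
  proof (intro nn_integral_cong)
    fix u :: real
    have "(\<integral>\<^sup>+x. indicator {u. ennreal u < f x} u * indicator {0<..<1} u \<partial>M)
        = (\<integral>\<^sup>+x. indicator {x\<in>space M. ennreal u < f x} x \<partial>M) * indicator {0<..<1} u"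
      by (subst nn_integral_multc[symmetric]) (auto intro!: nn_integral_cong simp: indicator_def)
    then show "(\<integral>\<^sup>+x. indicator {u. ennreal u < f x} u * indicator {0<..<1} u \<partial>M)
        = emeasure M {x\<in>space M. ennreal u < f x} * indicator {0<..<1} u"
      by simp
  qed
  finally show ?thesis .
qed

text \<open>As \<open>f\<close> and \<open>g\<close> both come arbitrarily close to 1, their
  superlevel sets are nonempty at every height below 1, and Brunn-Minkowski applies height by
  height. The result bounds the arithmetic mean of the integrals, which is stronger than a bound on
  the geometric mean.\<close>

lemma prekopa_leindler_real_normalized:
  fixes f g h :: "real \<Rightarrow> ennreal"
  assumes [measurable]: "f \<in> borel_measurable borel" "g \<in> borel_measurable borel" "h \<in> borel_measurable borel"
    and t: "0 < t" "t < 1"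
    and f: "\<And>x. f x \<le> 1" "\<And>u. u < 1 \<Longrightarrow> \<exists>x. u < f x"
    and g: "\<And>x. g x \<le> 1" "\<And>u. u < 1 \<Longrightarrow> \<exists>x. u < g x"
    and h: "\<And>u x y. u < f x \<Longrightarrow> u < g y \<Longrightarrow> u \<le> h ((1 - t) * x + t * y)"
  shows "ennreal (1 - t) * (\<integral>\<^sup>+x. f x \<partial>lborel) + ennreal t * (\<integral>\<^sup>+x. g x \<partial>lborel) \<le> (\<integral>\<^sup>+x. h x \<partial>lborel)"
proof -
  \<comment> \<open>Capping at 1 can only lower the integral, and it confines the layer-cake formula
    for \<open>h\<close> to the heights where those for \<open>f\<close> and \<open>g\<close>
    live.\<close>
  define h' where "h' x = min 1 (h x)" for x
  have [measurable]: "h' \<in> borel_measurable borel" by (simp add: h'_def[abs_def])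
  let ?L = "\<lambda>f u. emeasure lborel {x. ennreal u < f x}"
  have eq: "(\<integral>\<^sup>+x. f x \<partial>lborel) = (\<integral>\<^sup>+u\<in>{0<..<1}. ?L f u \<partial>lborel)"
    if [measurable]: "f \<in> borel_measurable borel" and "\<And>x. f x \<le> 1" for f :: "real \<Rightarrow> ennreal"
    using that layer_cake_le_one[of lborel f] by (simp add: sigma_finite_lborel)
  have meas: "(\<lambda>u. ?L f u) \<in> borel_measurable borel" if [measurable]: "f \<in> borel_measurable borel" for f :: "real \<Rightarrow> ennreal"
    using lborel.measurable_emeasure_Pair[of "{p. ennreal (fst p) < f (snd p)}" borel] by simp
  note [measurable] = meas[OF assms(1)] meas[OF assms(2)]
  have "ennreal (1 - t) * (\<integral>\<^sup>+x. f x \<partial>lborel) + ennreal t * (\<integral>\<^sup>+x. g x \<partial>lborel)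
     = (\<integral>\<^sup>+u\<in>{0<..<1}. (ennreal (1 - t) * ?L f u + ennreal t * ?L g u) \<partial>lborel)"
    using f g by (simp add: eq distrib_right mult.assoc nn_integral_add nn_integral_cmult)
  also have "\<dots> \<le> (\<integral>\<^sup>+u\<in>{0<..<1}. ?L h' u \<partial>lborel)"
  proof (intro nn_integral_mono)
    fix u :: real
    have "ennreal (1 - t) * ?L f u + ennreal t * ?L g u \<le> ?L h' u" if "u \<in> {0<..<1}"
    proof (rule brunn_minkowski_real[OF _ _ _ _ _ t])
      show "{x. ennreal u < f x} \<noteq> {}" "{x. ennreal u < g x} \<noteq> {}"
        using f(2) g(2) that by auto
      fix x y assume "x \<in> {x. ennreal u < f x}" "y \<in> {x. ennreal u < g x}"
      \<comment> \<open>The hypothesis on \<open>h\<close> gives a bound that is not strict, so it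
        is applied at a height strictly above \<open>u\<close>.\<close>
      then obtain v where v: "ennreal u < v" "v < f x" "v < g y"
        using dense[of "ennreal u" "min (f x) (g y)"] by auto
      then show "(1 - t) * x + t * y \<in> {x. ennreal u < h' x}"
        using h[of v x y] that by (auto simp: h'_def)
    qed auto
    then show "(ennreal (1 - t) * ?L f u + ennreal t * ?L g u) * indicator {0<..<1} u \<le> ?L h' u * indicator {0<..<1} u"
      by (auto simp: indicator_def)
  qed
  also have "\<dots> = (\<integral>\<^sup>+x. h' x \<partial>lborel)" by (rule eq[symmetric]) (auto simp: h'_def)
  also have "\<dots> \<le> (\<integral>\<^sup>+x. h x \<partial>lborel)" by (intro nn_integral_mono) (auto simp: h'_def)
  finally show ?thesis .
qed

text \<open>Prepares a function for the normalized inequality: truncation at a large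
  \<open>n\<close> makes the supremum \<open>a\<close> finite while the integral stays above
  \<open>p\<close>, and \<open>f'\<close> is the truncation divided by \<open>a\<close>.\<close>

lemma normalize_truncation:
  fixes f :: "real \<Rightarrow> ennreal"
  assumes [measurable]: "f \<in> borel_measurable borel" and p: "0 < p" "ennreal p < (\<integral>\<^sup>+x. f x \<partial>lborel)"
  obtains a f' where "0 < a" "f' \<in> borel_measurable borel" "\<And>x. f' x \<le> 1" "\<And>u. u < 1 \<Longrightarrow> \<exists>x. u < f' x"
    "\<And>x. ennreal a * f' x \<le> f x" "ennreal (p / a) \<le> (\<integral>\<^sup>+x. f' x \<partial>lborel)"
proof -
  have SUP_min: "(SUP n. min (f x) (of_nat n)) = f x" for x
  proof (rule antisym)
    show "f x \<le> (SUP n. min (f x) (of_nat n))"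
    proof (rule dense_le)
      fix c assume c: "c < f x"
      then have "c < top" using top.not_eq_extremum by fastforce
      then obtain n where "c < of_nat n" using ennreal_Ex_less_of_nat by blast
      with c show "c \<le> (SUP n. min (f x) (of_nat n))" by (intro SUP_upper2[of n]) auto
    qed
  qed (auto intro: SUP_least)
  have "(\<integral>\<^sup>+x. (SUP n. min (f x) (of_nat n)) \<partial>lborel) = (SUP n. \<integral>\<^sup>+x. min (f x) (of_nat n) \<partial>lborel)"
    by (intro nn_integral_monotone_convergence_SUP) (auto simp: incseq_def le_fun_def intro: min.coboundedI2)
  then obtain n where n: "ennreal p < (\<integral>\<^sup>+x. min (f x) (of_nat n) \<partial>lborel)"
    using p(2) by (auto simp: SUP_min less_SUP_iff)
  define F where "F x = min (f x) (of_nat n)" for x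
  have [measurable]: "F \<in> borel_measurable borel" by (simp add: F_def[abs_def])
  have "(SUP x. F x) \<le> of_nat n" by (auto intro!: SUP_least simp: F_def)
  then have "(SUP x. F x) < top" using of_nat_less_top le_less_trans by blast
  then obtain a where a: "(SUP x. F x) = ennreal a" "0 \<le> a" by (cases "SUP x. F x") auto
  have le: "F x \<le> ennreal a" for x unfolding a(1)[symmetric] by (rule SUP_upper) simp
  have "a \<noteq> 0"
  proof
    assume "a = 0"
    with le have "F x = 0" for x by simp
    with n show False by (simp add: F_def)
  qed
  with a have a0: "0 < a" by simp
  show thesis
  proof (rule that[of a "\<lambda>x. ennreal (1 / a) * F x"])
    have *: "ennreal a * (ennreal (1 / a) * y) = y" for y
      using a0 by (simp flip: mult.assoc ennreal_mult)
    have **: "ennreal (1 / a) * (ennreal a * y) = y" for y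
      using a0 by (simp flip: mult.assoc ennreal_mult)
    show "ennreal (1 / a) * F x \<le> 1" for x
      using mult_left_mono[OF le[of x], of "ennreal (1 / a)"] **[of 1] by simp
    show "\<exists>x. u < ennreal (1 / a) * F x" if "u < 1" for u
    proof -
      have "ennreal a * u < (SUP x. F x)"
        unfolding a(1) using ennreal_mult_strict_left_mono[OF that, of "ennreal a"] a0 by simp
      then obtain x where x: "ennreal a * u < F x" by (auto simp: less_SUP_iff)
      have "ennreal (1 / a) * (ennreal a * u) < ennreal (1 / a) * F x"
        using ennreal_mult_strict_left_mono[OF x, of "ennreal (1/a)"] a0 by simp
      then show ?thesis by (auto simp: **)
    qed
    show "ennreal a * (ennreal (1 / a) * F x) \<le> f x" for x by (simp add: * F_def)
    have "ennreal (p / a) = ennreal (1 / a) * ennreal p"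
      using p a0 by (simp flip: ennreal_mult)
    also have "\<dots> \<le> ennreal (1 / a) * (\<integral>\<^sup>+x. F x \<partial>lborel)"
      using n by (intro mult_left_mono) (auto simp: F_def)
    finally show "ennreal (p / a) \<le> (\<integral>\<^sup>+x. ennreal (1 / a) * F x \<partial>lborel)"
      by (simp add: nn_integral_cmult)
  qed (use a0 in auto)
qed

text \<open>The values and integrals lie in \<open>ennreal\<close> and may be infinite, so geometric
  means are taken of positive reals \<open>p\<close>, \<open>q\<close> strictly below them.
  Hypothesis and conclusion have the same shape, which is what lets the inequality be iterated over
  coordinates.\<close>

lemma prekopa_leindler_real:
  fixes f g h :: "real \<Rightarrow> ennreal"
  assumes [measurable]: "f \<in> borel_measurable borel" "g \<in> borel_measurable borel" "h \<in> borel_measurable borel"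
    and t: "0 < t" "t < 1"
    and h: "\<And>x y p q. 0 < p \<Longrightarrow> 0 < q \<Longrightarrow> ennreal p < f x \<Longrightarrow> ennreal q < g y \<Longrightarrow>
      ennreal (p powr (1 - t) * q powr t) \<le> h ((1 - t) * x + t * y)"
    and p: "0 < p" "ennreal p < (\<integral>\<^sup>+x. f x \<partial>lborel)" and q: "0 < q" "ennreal q < (\<integral>\<^sup>+x. g x \<partial>lborel)"
  shows "ennreal (p powr (1 - t) * q powr t) \<le> (\<integral>\<^sup>+x. h x \<partial>lborel)"
proof -
  obtain a f' where a: "0 < a" "f' \<in> borel_measurable borel" "\<And>x. f' x \<le> 1" "\<And>u. u < 1 \<Longrightarrow> \<exists>x. u < f' x"
      "\<And>x. ennreal a * f' x \<le> f x" "ennreal (p / a) \<le> (\<integral>\<^sup>+x. f' x \<partial>lborel)"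
    using normalize_truncation[OF assms(1) p] by metis
  obtain b g' where b: "0 < b" "g' \<in> borel_measurable borel" "\<And>x. g' x \<le> 1" "\<And>u. u < 1 \<Longrightarrow> \<exists>x. u < g' x"
      "\<And>x. ennreal b * g' x \<le> g x" "ennreal (q / b) \<le> (\<integral>\<^sup>+x. g' x \<partial>lborel)"
    using normalize_truncation[OF assms(2) q] by metis
  \<comment> \<open>Dividing \<open>f\<close> and \<open>g\<close> by their truncated suprema
    \<open>a\<close> and \<open>b\<close> means dividing \<open>h\<close> by the weighted geometric
    mean of \<open>a\<close> and \<open>b\<close>.\<close>
  define c where "c = a powr (1 - t) * b powr t"
  have c: "0 < c" using a b by (simp add: c_def)
  have "ennreal (1 - t) * (\<integral>\<^sup>+x. f' x \<partial>lborel) + ennreal t * (\<integral>\<^sup>+x. g' x \<partial>lborel)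
      \<le> (\<integral>\<^sup>+x. ennreal (1 / c) * h x \<partial>lborel)"
  proof (rule prekopa_leindler_real_normalized[OF _ _ _ t])
    fix u x y assume u: "u < f' x" "u < g' y"
    then have "u < 1" using a(3)[of x] by auto
    then obtain v where v: "u = ennreal v" "0 \<le> v" by (cases u) auto
    show "u \<le> ennreal (1 / c) * h ((1 - t) * x + t * y)"
    proof (cases "v = 0")
      case False
      with v have v0: "0 < v" by simp
      have "ennreal (a * v) < ennreal a * f' x" "ennreal (b * v) < ennreal b * g' y"
        using u v0 a(1) b(1) ennreal_mult_strict_left_mono[OF u(1), of "ennreal a"]
          ennreal_mult_strict_left_mono[OF u(2), of "ennreal b"] by (simp_all add: ennreal_mult v)
      then have "ennreal ((a * v) powr (1 - t) * (b * v) powr t) \<le> h ((1 - t) * x + t * y)"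
        using a(1,5) b(1,5) v0 by (intro h) (auto intro: less_le_trans)
      also have "(a * v) powr (1 - t) * (b * v) powr t = c * v"
        using a(1) b(1) v0 by (simp add: c_def powr_mult powr_diff)
      finally have "ennreal (1 / c) * ennreal (c * v) \<le> ennreal (1 / c) * h ((1 - t) * x + t * y)"
        by (rule mult_left_mono) simp
      then show ?thesis using c v0 v by (simp flip: ennreal_mult)
    qed (simp add: v)
  qed (use a b in auto)
  then have *: "ennreal (1 - t) * (\<integral>\<^sup>+x. f' x \<partial>lborel) + ennreal t * (\<integral>\<^sup>+x. g' x \<partial>lborel)
      \<le> ennreal (1 / c) * (\<integral>\<^sup>+x. h x \<partial>lborel)" by (simp add: nn_integral_cmult)
  \<comment> \<open>Young's inequality passes from the arithmetic mean of the normalized case to the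
    geometric one.\<close>
  have "(p / a) powr (1 - t) * (q / b) powr t \<le> (1 - t) * (p / a) + t * (q / b)"
    using a b p q t by (intro Youngs_inequality_0) auto
  then have "ennreal (p powr (1 - t) * q powr t / c) \<le> ennreal (1 - t) * ennreal (p / a) + ennreal t * ennreal (q / b)"
    using a b p q t by (simp add: c_def powr_divide flip: ennreal_mult ennreal_plus)
  also have "\<dots> \<le> ennreal (1 - t) * (\<integral>\<^sup>+x. f' x \<partial>lborel) + ennreal t * (\<integral>\<^sup>+x. g' x \<partial>lborel)"
    by (intro add_mono mult_left_mono a b) auto
  also note *
  finally have "ennreal c * ennreal (p powr (1 - t) * q powr t / c) \<le> ennreal c * (ennreal (1 / c) * (\<integral>\<^sup>+x. h x \<partial>lborel))"
    by (rule mult_left_mono) simp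
  then show ?thesis using c by (simp flip: mult.assoc ennreal_mult)
qed

section \<open>Prekopa-Leindler and linear forms in product coordinates\<close>

interpretation lborel_prod: product_sigma_finite "\<lambda>_. lborel :: real measure" ..

text \<open>Induction on the coordinates: by the inequality on the line, integrating out the
  coordinate \<open>i\<close> preserves the hypothesis. Points of the product space are
  \<open>undefined\<close> off \<open>B\<close>, hence \<open>extensional\<close> and the restricted
  convex combination.\<close>

lemma prekopa_leindler_PiM:
  fixes f g h :: "('b \<Rightarrow> real) \<Rightarrow> ennreal"
  assumes "finite B"
    and "f \<in> borel_measurable (\<Pi>\<^sub>M b\<in>B. lborel)" "g \<in> borel_measurable (\<Pi>\<^sub>M b\<in>B. lborel)"
      "h \<in> borel_measurable (\<Pi>\<^sub>M b\<in>B. lborel)"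
    and t: "0 < t" "t < 1"
    and "\<And>x y p q. x \<in> extensional B \<Longrightarrow> y \<in> extensional B \<Longrightarrow> 0 < p \<Longrightarrow> 0 < q \<Longrightarrow>
      ennreal p < f x \<Longrightarrow> ennreal q < g y \<Longrightarrow>
      ennreal (p powr (1 - t) * q powr t) \<le> h (\<lambda>b\<in>B. (1 - t) * x b + t * y b)"
    and "0 < p" "ennreal p < (\<integral>\<^sup>+x. f x \<partial>(\<Pi>\<^sub>M b\<in>B. lborel))"
    and "0 < q" "ennreal q < (\<integral>\<^sup>+x. g x \<partial>(\<Pi>\<^sub>M b\<in>B. lborel))"
  shows "ennreal (p powr (1 - t) * q powr t) \<le> (\<integral>\<^sup>+x. h x \<partial>(\<Pi>\<^sub>M b\<in>B. lborel))"
  using assms(1-4,7-)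
proof (induction B arbitrary: f g h p q rule: finite_induct)
  case empty
  have "restrict (\<lambda>b. (1 - t) * undefined + t * undefined) {} = (\<lambda>_. undefined)" by auto
  with empty.prems show ?case
    by (auto simp: lborel_prod.nn_integral_empty restrict_def)
next
  case (insert i B)
  note [measurable] = insert.prems(1-3)
  have int: "(\<integral>\<^sup>+x. f x \<partial>(\<Pi>\<^sub>M b\<in>insert i B. lborel)) = (\<integral>\<^sup>+x. \<integral>\<^sup>+s. f (x(i := s)) \<partial>lborel \<partial>(\<Pi>\<^sub>M b\<in>B. lborel))"
    if "f \<in> borel_measurable (\<Pi>\<^sub>M b\<in>insert i B. lborel)" for f :: "('b \<Rightarrow> real) \<Rightarrow> ennreal"
    using insert.hyps that by (rule lborel_prod.product_nn_integral_insert)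
  show ?case
    unfolding int[OF insert.prems(3)]
  proof (rule insert.IH[of "\<lambda>x. \<integral>\<^sup>+s. f (x(i := s)) \<partial>lborel" "\<lambda>x. \<integral>\<^sup>+s. g (x(i := s)) \<partial>lborel"])
    fix x y :: "'b \<Rightarrow> real" and p q
    assume xy: "x \<in> extensional B" "y \<in> extensional B" and pq: "0 < p" "0 < q"
      "ennreal p < (\<integral>\<^sup>+s. f (x(i := s)) \<partial>lborel)" "ennreal q < (\<integral>\<^sup>+s. g (y(i := s)) \<partial>lborel)"
    let ?z = "\<lambda>b\<in>B. (1 - t) * x b + t * y b"
    have sp: "x \<in> space (\<Pi>\<^sub>M b\<in>B. lborel)" "y \<in> space (\<Pi>\<^sub>M b\<in>B. lborel)" "?z \<in> space (\<Pi>\<^sub>M b\<in>B. lborel)"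
      using xy by (auto simp: space_PiM PiE_def)
    have m: "(\<lambda>s. f (x(i := s))) \<in> borel_measurable borel"
      if [measurable]: "f \<in> borel_measurable (\<Pi>\<^sub>M b\<in>insert i B. lborel)" "x \<in> space (\<Pi>\<^sub>M b\<in>B. lborel)"
      for f :: "('b \<Rightarrow> real) \<Rightarrow> ennreal" and x
    proof -
      have "(\<lambda>s. x(i := s)) \<in> lborel \<rightarrow>\<^sub>M (\<Pi>\<^sub>M b\<in>insert i B. lborel)"
        using that(2) by measurable
      from measurable_compose[OF this that(1)] show ?thesis by simp
    qed
    show "ennreal (p powr (1 - t) * q powr t) \<le> (\<integral>\<^sup>+s. h (?z(i := s)) \<partial>lborel)"
    proof (rule prekopa_leindler_real[OF _ _ _ t _ pq(1,3,2,4)])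
      fix r s p q assume *: "0 < p" "0 < q" "ennreal p < f (x(i := r))" "ennreal q < g (y(i := s))"
      have "ennreal (p powr (1 - t) * q powr t) \<le> h (\<lambda>b\<in>insert i B. (1 - t) * (x(i := r)) b + t * (y(i := s)) b)"
        using xy by (intro insert.prems(4)[OF _ _ *]) (auto simp: extensional_def)
      also have "(\<lambda>b\<in>insert i B. (1 - t) * (x(i := r)) b + t * (y(i := s)) b) = ?z(i := (1 - t) * r + t * s)"
        using insert.hyps by (auto simp: fun_eq_iff restrict_def)
      finally show "ennreal (p powr (1 - t) * q powr t) \<le> h (?z(i := (1 - t) * r + t * s))" .
    qed (use m sp in auto)
  next
    show "ennreal p < (\<integral>\<^sup>+x. \<integral>\<^sup>+s. f (x(i := s)) \<partial>lborel \<partial>(\<Pi>\<^sub>M b\<in>B. lborel))"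
      "ennreal q < (\<integral>\<^sup>+x. \<integral>\<^sup>+s. g (x(i := s)) \<partial>lborel \<partial>(\<Pi>\<^sub>M b\<in>B. lborel))"
      using insert.prems(6,8) by (simp_all only: int[OF insert.prems(1)] int[OF insert.prems(2)])
  qed (measurable, use insert.prems in auto)
qed

lemma nn_integral_PiM_lborel_reflect:
  fixes f :: "('b \<Rightarrow> real) \<Rightarrow> ennreal"
  assumes "finite B" and "f \<in> borel_measurable (\<Pi>\<^sub>M b\<in>B. lborel)"
  shows "(\<integral>\<^sup>+x. f (\<lambda>b\<in>B. - x b) \<partial>(\<Pi>\<^sub>M b\<in>B. lborel)) = (\<integral>\<^sup>+x. f x \<partial>(\<Pi>\<^sub>M b\<in>B. lborel))"
  using assms
proof (induction B arbitrary: f rule: finite_induct)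
  case empty
  show ?case by (subst (1 2) lborel_prod.nn_integral_empty) (simp_all add: restrict_def)
next
  case (insert i B)
  note [measurable] = insert.prems
  have "(\<integral>\<^sup>+x. f (\<lambda>b\<in>insert i B. - x b) \<partial>(\<Pi>\<^sub>M b\<in>insert i B. lborel))
      = (\<integral>\<^sup>+x. \<integral>\<^sup>+s. f (\<lambda>b\<in>insert i B. - (x(i := s)) b) \<partial>lborel \<partial>(\<Pi>\<^sub>M b\<in>B. lborel))"
    by (rule lborel_prod.product_nn_integral_insert[OF insert.hyps]) measurable
  also have "\<dots> = (\<integral>\<^sup>+x. \<integral>\<^sup>+s. f ((\<lambda>b\<in>B. - x b)(i := s)) \<partial>lborel \<partial>(\<Pi>\<^sub>M b\<in>B. lborel))"
  proof (rule nn_integral_cong)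
    fix x :: "'b \<Rightarrow> real" assume "x \<in> space (\<Pi>\<^sub>M b\<in>B. lborel)"
    have eq: "(\<lambda>b\<in>insert i B. - (x(i := s)) b) = (\<lambda>b\<in>B. - x b)(i := 0 + - 1 * s)" for s
      using insert.hyps by (auto simp: fun_eq_iff restrict_def)
    have "(\<lambda>b\<in>B. - x b) \<in> space (\<Pi>\<^sub>M b\<in>B. lborel)" by (simp add: space_PiM)
    then have "(\<lambda>s. (\<lambda>b\<in>B. - x b)(i := s)) \<in> lborel \<rightarrow>\<^sub>M (\<Pi>\<^sub>M b\<in>insert i B. lborel)" by measurable
    from measurable_compose[OF this insert.prems]
    have "(\<lambda>s. f ((\<lambda>b\<in>B. - x b)(i := s))) \<in> borel_measurable borel" by simp
    from nn_integral_real_affine[OF this, of "- 1" 0]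
    show "(\<integral>\<^sup>+s. f (\<lambda>b\<in>insert i B. - (x(i := s)) b) \<partial>lborel) = (\<integral>\<^sup>+s. f ((\<lambda>b\<in>B. - x b)(i := s)) \<partial>lborel)"
      unfolding eq by simp
  qed
  also have "\<dots> = (\<integral>\<^sup>+x. \<integral>\<^sup>+s. f (x(i := s)) \<partial>lborel \<partial>(\<Pi>\<^sub>M b\<in>B. lborel))"
    by (rule insert.IH) measurable
  also have "\<dots> = (\<integral>\<^sup>+x. f x \<partial>(\<Pi>\<^sub>M b\<in>insert i B. lborel))"
    by (rule lborel_prod.product_nn_integral_insert[OF insert.hyps insert.prems, symmetric])
  finally show ?case .
qed

text \<open>Along the coordinate \<open>b0\<close> the form is affine with nonzero slope, so on
  every line in that direction the preimage of \<open>N\<close> is null; Fubini does the rest. This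
  supplies absolute continuity for Radon-Nikodym and allows densities to be changed on null
  sets.\<close>

lemma AE_PiM_linear_form_notin_null_set:
  fixes u :: "'b \<Rightarrow> real"
  assumes "finite B" "b0 \<in> B" "u b0 \<noteq> 0" and N: "N \<in> null_sets lborel"
  shows "AE x in (\<Pi>\<^sub>M b\<in>B. lborel). (\<Sum>b\<in>B. u b * x b) \<notin> N"
proof -
  define B' where "B' = B - {b0}"
  have B: "B = insert b0 B'" "finite B'" "b0 \<notin> B'" using assms by (auto simp: B'_def)
  have [measurable]: "N \<in> sets borel" using N by auto
  have "(\<integral>\<^sup>+x. indicator N (\<Sum>b\<in>B. u b * x b) \<partial>(\<Pi>\<^sub>M b\<in>B. lborel))
      = (\<integral>\<^sup>+x. \<integral>\<^sup>+s. indicator N (\<Sum>b\<in>B. u b * (x(b0 := s)) b) \<partial>lborel \<partial>(\<Pi>\<^sub>M b\<in>B'. lborel))"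
    unfolding B(1) by (rule lborel_prod.product_nn_integral_insert[OF B(2,3)]) measurable
  also have "\<dots> = (\<integral>\<^sup>+x. 0 \<partial>(\<Pi>\<^sub>M b\<in>B'. (lborel :: real measure)))"
  proof (rule nn_integral_cong)
    fix x :: "'b \<Rightarrow> real"
    have eq: "(\<Sum>b\<in>B. u b * (x(b0 := s)) b) = (\<Sum>b\<in>B'. u b * x b) + u b0 * s" for s
    proof -
      have "(\<Sum>b\<in>B'. u b * (x(b0 := s)) b) = (\<Sum>b\<in>B'. u b * x b)"
        using B by (intro sum.cong) auto
      then show ?thesis using B by simp
    qed
    have "(\<integral>\<^sup>+s. indicator N s \<partial>lborel) = ennreal \<bar>u b0\<bar> *
        (\<integral>\<^sup>+s. indicator N ((\<Sum>b\<in>B'. u b * x b) + u b0 * s) \<partial>lborel)"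
      using assms by (intro nn_integral_real_affine) auto
    moreover have "(\<integral>\<^sup>+s. indicator N s \<partial>lborel) = 0" using N by auto
    ultimately show "(\<integral>\<^sup>+s. indicator N (\<Sum>b\<in>B. u b * (x(b0 := s)) b) \<partial>lborel) = 0"
      unfolding eq using assms by auto
  qed
  finally have "(\<integral>\<^sup>+x. indicator N (\<Sum>b\<in>B. u b * x b) \<partial>(\<Pi>\<^sub>M b\<in>B. lborel)) = 0" by simp
  then have "AE x in (\<Pi>\<^sub>M b\<in>B. lborel). indicator N (\<Sum>b\<in>B. u b * x b) = (0::ennreal)"
    by (subst (asm) nn_integral_0_iff_AE) measurable
  then show ?thesis by (auto simp: indicator_def)
qed

text \<open>The point \<open>\<lambda>c\<close> is a convex combination of \<open>c\<close> and \<open>-c\<close>, and the parallel slabs with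
  centres \<open>c\<close> and \<open>-c\<close> are reflections of each other up to their boundaries.\<close>

lemma nn_integral_slabs_slide:
  fixes u :: "'i \<Rightarrow> 'b \<Rightarrow> real" and c r :: "'i \<Rightarrow> real"
  assumes "finite B" "finite I" and l: "0 \<le> l" "l \<le> 1"
  defines "P \<equiv> (\<Pi>\<^sub>M b\<in>B. lborel) :: ('b \<Rightarrow> real) measure"
  shows "(\<integral>\<^sup>+x. (\<Prod>i\<in>I. indicator {c i - r i..<c i + r i} (\<Sum>b\<in>B. u i b * x b)) \<partial>P)
    \<le> (\<integral>\<^sup>+x. (\<Prod>i\<in>I. indicator {l * c i - r i..<l * c i + r i} (\<Sum>b\<in>B. u i b * x b)) \<partial>P)"
    (is "(\<integral>\<^sup>+x. ?f x \<partial>P) \<le> (\<integral>\<^sup>+x. ?h x \<partial>P)")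
proof (cases "l = 1")
  case False
  \<comment> \<open>With this \<open>t\<close>,
    \<open>(1 - t) * c + t * (- c) = l * c\<close>.\<close>
  define t where "t = (1 - l) / 2"
  have t: "0 < t" "t < 1" "l = 1 - 2 * t" using l False by (auto simp: t_def field_simps)
  have prod_ind: "(\<Prod>i\<in>I. indicator (S i) (y i)) = (if \<forall>i\<in>I. y i \<in> S i then 1 else 0 :: ennreal)"
    for S :: "'i \<Rightarrow> real set" and y
  proof (cases "\<forall>i\<in>I. y i \<in> S i")
    case True then show ?thesis by (auto intro!: prod.neutral)
  next
    case False then show ?thesis using \<open>finite I\<close> by (auto intro!: prod_zero simp: indicator_def)
  qed
  let ?g = "\<lambda>x. ?f (\<lambda>b\<in>B. - x b)"
  have [measurable]: "?f \<in> borel_measurable P" "?h \<in> borel_measurable P"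
    unfolding P_def by measurable
  have eq: "?g = (\<lambda>x. \<Prod>i\<in>I. indicator {c i - r i..<c i + r i} (\<Sum>b\<in>B. u i b * - x b))" by simp
  have g[measurable]: "?g \<in> borel_measurable P" unfolding eq P_def by measurable
  have int_g: "(\<integral>\<^sup>+x. ?g x \<partial>P) = (\<integral>\<^sup>+x. ?f x \<partial>P)"
    unfolding P_def by (rule nn_integral_PiM_lborel_reflect[OF \<open>finite B\<close>]) measurable
  show ?thesis
  proof (rule dense_le)
    fix v assume v: "v < (\<integral>\<^sup>+x. ?f x \<partial>P)"
    then have "v < top" using top.not_eq_extremum by fastforce
    then obtain p where p: "v = ennreal p" "0 \<le> p" by (cases v) auto
    show "v \<le> (\<integral>\<^sup>+x. ?h x \<partial>P)"
    proof (cases "p = 0")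
      case False
      with p have p0: "0 < p" by simp
      have "ennreal (p powr (1 - t) * p powr t) \<le> (\<integral>\<^sup>+x. ?h x \<partial>P)"
        unfolding P_def
      proof (rule prekopa_leindler_PiM[where f = ?f and g = ?g, OF \<open>finite B\<close> _ _ _ t(1,2)])
        fix x y :: "'b \<Rightarrow> real" and p q :: real
        assume pq: "0 < p" "0 < q" "ennreal p < ?f x" "ennreal q < ?g y"
        let ?L = "\<lambda>i x. \<Sum>b\<in>B. u i b * x b"
        have x: "?L i x \<in> {c i - r i..<c i + r i}" if "i \<in> I" for i
          using pq(3) that unfolding prod_ind by (auto split: if_splits)
        have y: "- ?L i y \<in> {c i - r i..<c i + r i}" if "i \<in> I" for i
          using pq(4) that unfolding prod_ind by (auto split: if_splits simp: sum_negf)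
        \<comment> \<open>Both integrands take only the values 0 and 1, so it suffices that the
          combined point lies in every slid slab.\<close>
        have "p < 1" "q < 1" using pq unfolding prod_ind by (auto split: if_splits)
        then have "p powr (1 - t) * q powr t \<le> 1"
          using pq t powr_le1[of "1 - t" p] powr_le1[of t q] by (intro mult_le_one) auto
        moreover have "?h (\<lambda>b\<in>B. (1 - t) * x b + t * y b) = 1"
        proof -
          have "?L i (\<lambda>b\<in>B. (1 - t) * x b + t * y b) \<in> {l * c i - r i..<l * c i + r i}" if i: "i \<in> I" for i
          proof -
            have *: "?L i (\<lambda>b\<in>B. (1 - t) * x b + t * y b) = (1 - t) * ?L i x + t * ?L i y"
              by (simp add: sum_distrib_left sum.distrib[symmetric] algebra_simps)
            \<comment> \<open>Reflection moves the open end of the interval to the left, so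
              \<open>y\<close> gives only a weak upper bound. The strict one for the half-open
              target comes from \<open>x\<close>, as \<open>1 - t > 0\<close>.\<close>
            have "(1 - t) * (c i - r i) \<le> (1 - t) * ?L i x" "(1 - t) * ?L i x < (1 - t) * (c i + r i)"
              using x[OF i] t by auto
            moreover have "t * (- c i - r i) \<le> t * ?L i y" "t * ?L i y \<le> t * (- c i + r i)"
              using y[OF i] t by (auto intro!: mult_left_mono)
            ultimately show ?thesis unfolding * t(3) atLeastLessThan_iff by (auto simp: algebra_simps)
          qed
          then show ?thesis unfolding prod_ind by simp
        qed
        ultimately show "ennreal (p powr (1 - t) * q powr t) \<le> ?h (\<lambda>b\<in>B. (1 - t) * x b + t * y b)"
          by simp
      qed (use v p p0 int_g g in \<open>simp_all flip: P_def\<close>)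
      also have "p powr (1 - t) * p powr t = p" using p0 by (simp flip: powr_add)
      finally show ?thesis using p by simp
    qed (use p in simp)
  qed
qed simp

section \<open>Sliding and merging intervals\<close>

text \<open>A pair \<open>(c, r)\<close> stands for the half-open interval with centre \<open>c\<close> and radius \<open>r\<close>, so that
  touching intervals are disjoint; the factor \<open>l\<close> below moves the centres only.\<close>

definition separated :: "(real \<times> real) set \<Rightarrow> bool" where
  "separated S \<longleftrightarrow> finite S \<and> (\<forall>p\<in>S. 0 < snd p) \<and>
    (\<forall>p\<in>S. \<forall>q\<in>S. p \<noteq> q \<longrightarrow> snd p + snd q \<le> \<bar>fst p - fst q\<bar>)"

definition scaled_interval :: "real \<Rightarrow> real \<times> real \<Rightarrow> real set" where
  "scaled_interval l p = {l * fst p - snd p..<l * fst p + snd p}"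

text \<open>A sum rather than the indicator of a union, so that a product of such functions expands
  into indicators of intersections of slabs. For separated intervals and \<open>l = 1\<close> the
  two agree; overlaps at smaller \<open>l\<close> are counted with multiplicity.\<close>

definition interval_sum :: "real \<Rightarrow> (real \<times> real) set \<Rightarrow> real \<Rightarrow> ennreal" where
  "interval_sum l S y = (\<Sum>p\<in>S. indicator (scaled_interval l p) y)"

text \<open>By \<open>touch\<close> the union of the two half-open intervals is again half-open,
  with no point lost or counted twice. Its ends are \<open>fst p - snd p\<close> and
  \<open>fst p + snd p + 2 * snd q\<close>, whence the new centre and radius.\<close>

lemma merge_intervals:
  assumes S: "separated S" and pq: "p \<in> S" "q \<in> S" and touch: "fst q = fst p + snd p + snd q"
  defines "T \<equiv> insert (fst p + snd q, snd p + snd q) (S - {p, q})"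
  shows "separated T" "interval_sum 1 T = interval_sum 1 S" "(\<Sum>x\<in>T. snd x) = (\<Sum>x\<in>S. snd x)"
    "card T < card S"
proof -
  let ?m = "(fst p + snd q, snd p + snd q)"
  have fin: "finite S" and pos: "\<And>x. x \<in> S \<Longrightarrow> 0 < snd x"
    and sep: "\<And>x y. x \<in> S \<Longrightarrow> y \<in> S \<Longrightarrow> x \<noteq> y \<Longrightarrow> snd x + snd y \<le> \<bar>fst x - fst y\<bar>"
    using S by (auto simp: separated_def)
  have "p \<noteq> q" using touch pos[OF pq(1)] pos[OF pq(2)] by auto
  \<comment> \<open>A third interval does not fit between the touching \<open>p\<close> and
    \<open>q\<close>, so it lies to one side of both.\<close>
  have m: "snd ?m + snd x \<le> \<bar>fst ?m - fst x\<bar>" if "x \<in> S - {p, q}" for x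
    using sep[of p x] sep[of q x] that pq touch pos[of x] pos[OF pq(1)] pos[OF pq(2)] by auto
  \<comment> \<open>If the merged pair were already present, \<open>insert\<close> would add nothing
    and the total length would drop.\<close>
  have m': "?m \<notin> S - {p, q}"
    using m[of ?m] pos[OF pq(1)] pos[OF pq(2)] by auto
  have sum_S: "(\<Sum>x\<in>S. f x) = f p + f q + (\<Sum>x\<in>S - {p, q}. f x)" for f :: "real \<times> real \<Rightarrow> 'c::comm_monoid_add"
    using fin pq \<open>p \<noteq> q\<close> by (subst sum.subset_diff[of "{p, q}" S]) (auto simp: add.commute)
  have sum_T: "(\<Sum>x\<in>T. f x) = f ?m + (\<Sum>x\<in>S - {p, q}. f x)" for f :: "real \<times> real \<Rightarrow> 'c::comm_monoid_add"
    unfolding T_def using fin m' by (subst sum.insert) auto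
  show "separated T"
    using fin pos sep m pq unfolding separated_def T_def
    by (auto simp: abs_minus_commute add.commute add_pos_pos)
  show "interval_sum 1 T = interval_sum 1 S"
  proof
    fix y
    have "indicator (scaled_interval 1 ?m) y = (indicator (scaled_interval 1 p) y + indicator (scaled_interval 1 q) y :: ennreal)"
      using touch pos[OF pq(1)] pos[OF pq(2)] by (auto simp: scaled_interval_def indicator_def)
    then show "interval_sum 1 T y = interval_sum 1 S y"
      unfolding interval_sum_def sum_S sum_T by simp
  qed
  show "(\<Sum>x\<in>T. snd x) = (\<Sum>x\<in>S. snd x)" unfolding sum_S sum_T by simp
  have "card T = Suc (card (S - {p, q}))" unfolding T_def using fin m' by simp
  also have "card (S - {p, q}) = card S - 2" using fin pq \<open>p \<noteq> q\<close> by (subst card_Diff_subset) auto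
  finally show "card T < card S"
    using card_mono[OF fin, of "{p, q}"] pq \<open>p \<noteq> q\<close> by auto
qed

text \<open>In the application \<open>B\<close> is an orthonormal basis of the orthogonal complement
  of a subspace, and \<open>form i\<close> is the i-th coordinate of the point with coefficients
  \<open>x\<close>. A nonzero form does not see null sets of values.\<close>

locale linear_forms =
  fixes B :: "'b set" and I :: "'i set" and u :: "'i \<Rightarrow> 'b \<Rightarrow> real"
  assumes finite_B: "finite B" and finite_I: "finite I" and nonzero: "\<And>i. i \<in> I \<Longrightarrow> \<exists>b\<in>B. u i b \<noteq> 0"
begin

definition P :: "('b \<Rightarrow> real) measure" where "P = (\<Pi>\<^sub>M b\<in>B. lborel)"

definition form :: "'i \<Rightarrow> ('b \<Rightarrow> real) \<Rightarrow> real" where "form i x = (\<Sum>b\<in>B. u i b * x b)"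

definition \<Phi> :: "('i \<Rightarrow> real \<Rightarrow> ennreal) \<Rightarrow> ennreal" where
  "\<Phi> f = (\<integral>\<^sup>+x. (\<Prod>i\<in>I. f i (form i x)) \<partial>P)"

lemma measurable_form [measurable]: "form i \<in> borel_measurable P"
  unfolding form_def[abs_def] P_def by measurable

lemma \<Phi>_mono: "(\<And>i y. i \<in> I \<Longrightarrow> f i y \<le> g i y) \<Longrightarrow> \<Phi> f \<le> \<Phi> g"
  unfolding \<Phi>_def by (intro nn_integral_mono prod_mono_ennreal) auto

text \<open>Expanding the product of sums chooses one interval for each form. Every choice is an
  integral over an intersection of slabs, and all of these slide with the same
  \<open>l\<close>.\<close>

lemma \<Phi>_interval_sum_slide:
  assumes fin: "\<And>i. i \<in> I \<Longrightarrow> finite (S i)" and l: "0 \<le> l" "l \<le> 1"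
  shows "\<Phi> (\<lambda>i. interval_sum 1 (S i)) \<le> \<Phi> (\<lambda>i. interval_sum l (S i))"
proof -
  have [measurable]: "scaled_interval l p \<in> sets borel" for l p by (simp add: scaled_interval_def)
  have *: "\<Phi> (\<lambda>i. interval_sum l (S i))
    = (\<Sum>p\<in>PiE I S. \<integral>\<^sup>+x. (\<Prod>i\<in>I. indicator (scaled_interval l (p i)) (form i x)) \<partial>P)" for l
    using finite_I fin unfolding \<Phi>_def interval_sum_def
    by (simp add: prod_sum_PiE nn_integral_sum)
  show ?thesis
    unfolding * scaled_interval_def form_def P_def mult_1
    using finite_B finite_I l by (intro sum_mono nn_integral_slabs_slide)
qed

text \<open>All intervals are slid towards the origin at speeds proportional to their centres until
  two of them touch; these are merged, and the number of intervals drops.\<close>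

lemma \<Phi>_separated_le:
  assumes "\<And>i. i \<in> I \<Longrightarrow> separated (S i)" "\<And>i. i \<in> I \<Longrightarrow> (\<Sum>p\<in>S i. snd p) \<le> 1 / 2"
  shows "\<Phi> (\<lambda>i. interval_sum 1 (S i)) \<le> \<Phi> (\<lambda>i. indicator {-1/2..1/2})"
  using assms
proof (induction "\<Sum>i\<in>I. card (S i)" arbitrary: S rule: less_induct)
  case less
  have fin: "finite (S i)" and pos: "\<And>x. x \<in> S i \<Longrightarrow> 0 < snd x" if "i \<in> I" for i
    using less.prems(1)[OF that] by (auto simp: separated_def)
  have sep: "snd x + snd y \<le> \<bar>fst x - fst y\<bar>" if "i \<in> I" "x \<in> S i" "y \<in> S i" "x \<noteq> y" for i x y
    using less.prems(1)[OF that(1)] that by (auto simp: separated_def)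
  \<comment> \<open>\<open>\<rho> p q\<close> is the factor at which the two intervals touch: there
    the distance of the scaled centres equals the sum of the radii.\<close>
  define \<rho> where "\<rho> p q = (snd p + snd q) / \<bar>fst p - fst q\<bar>" for p q :: "real \<times> real"
  define E where "E = (\<lambda>(i, p, q). \<rho> p q) ` (SIGMA i:I. {(p, q) \<in> S i \<times> S i. p \<noteq> q})"
  have "finite {(p, q) \<in> S i \<times> S i. p \<noteq> q}" if "i \<in> I" for i
    by (rule finite_subset[of _ "S i \<times> S i"]) (use fin[OF that] in auto)
  then have finE: "finite E" using finite_I by (auto simp: E_def intro!: finite_SigmaI)
  have E_I: "\<rho> p q \<in> E" if "i \<in> I" "p \<in> S i" "q \<in> S i" "p \<noteq> q" for i p q
    unfolding E_def by (rule image_eqI[of _ _ "(i, p, q)"]) (use that in auto)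
  have E_E: "\<exists>i\<in>I. \<exists>p\<in>S i. \<exists>q\<in>S i. p \<noteq> q \<and> e = \<rho> p q" if "e \<in> E" for e
  proof -
    from that obtain z where z: "z \<in> (SIGMA i:I. {(p, q) \<in> S i \<times> S i. p \<noteq> q})" "e = (\<lambda>(i, p, q). \<rho> p q) z"
      unfolding E_def by (rule imageE)
    obtain i p q where "z = (i, p, q)" by (rule prod_cases3)
    with z show ?thesis by (intro bexI[of _ i] bexI[of _ p] bexI[of _ q]) simp_all
  qed
  show ?case
  proof (cases "E = {}")
    case True
    have single: "p = q" if "i \<in> I" "p \<in> S i" "q \<in> S i" for i p q
    proof (rule ccontr)
      assume "p \<noteq> q"
      with that have "\<rho> p q \<in> E" by (intro E_I)
      with True show False by simp
    qed
    \<comment> \<open>No union has two intervals left, so nothing obstructs sliding to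
      \<open>l = 0\<close>, where each interval is centred and has radius at most 1/2.\<close>
    show ?thesis
    proof (rule order_trans[OF \<Phi>_interval_sum_slide[of S 0] \<Phi>_mono])
      fix i y assume i: "i \<in> I"
      show "interval_sum 0 (S i) y \<le> indicator {-1/2..1/2} y"
      proof (cases "S i = {}")
        case False
        then obtain p where "p \<in> S i" by auto
        moreover have "q = p" if "q \<in> S i" for q
          using single[OF i that \<open>p \<in> S i\<close>] .
        ultimately have p: "S i = {p}" by blast
        then have "interval_sum 0 (S i) y = indicator (scaled_interval 0 p) y"
            by (simp add: interval_sum_def)
          then show ?thesis using less.prems(2)[OF i] p by (auto simp: scaled_interval_def indicator_def)
      qed (simp add: interval_sum_def)
    qed (use fin in auto)
  next
    case False
    \<comment> \<open>As the factor decreases from 1, the largest contact factor is met first, so no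
      pair overlaps at \<open>l\<close>.\<close>
    define l where "l = Max E"
    have le1: "0 < e" "e \<le> 1" if "e \<in> E" for e
    proof -
      obtain i p q where "i \<in> I" "p \<in> S i" "q \<in> S i" "p \<noteq> q" "e = \<rho> p q"
        using E_E[OF \<open>e \<in> E\<close>] by metis
      moreover from this have "snd p + snd q \<le> \<bar>fst p - fst q\<bar>" "0 < snd p + snd q"
        using sep[of i p q] pos[of i p] pos[of i q] by auto
      ultimately show "0 < e" "e \<le> 1" by (auto simp: \<rho>_def intro!: divide_pos_pos)
    qed
    have "l \<in> E" unfolding l_def using finE False by (rule Max_in)
    with le1 have l: "0 < l" "l \<le> 1" by auto
    obtain i0 p0 q0 where *: "i0 \<in> I" "p0 \<in> S i0" "q0 \<in> S i0" "p0 \<noteq> q0" "l = \<rho> p0 q0"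
      using E_E[OF \<open>l \<in> E\<close>] by metis
    have "\<exists>p\<in>S i0. \<exists>q\<in>S i0. l * fst q = l * fst p + snd p + snd q"
    proof -
      have "fst p0 \<noteq> fst q0" using l *(5) by (auto simp: \<rho>_def)
      then show ?thesis
      proof (cases "fst p0" "fst q0" rule: linorder_cases)
        case less
        then have "l * fst q0 = l * fst p0 + snd p0 + snd q0" using *(5) by (auto simp: \<rho>_def field_simps)
        then show ?thesis using *(2,3) by blast
      next
        case greater
        then have "l * fst p0 = l * fst q0 + snd q0 + snd p0" using *(5) by (auto simp: \<rho>_def field_simps)
        then show ?thesis using *(2,3) by blast
      qed simp
    qed
    then obtain p q where pq: "p \<in> S i0" "q \<in> S i0" "l * fst q = l * fst p + snd p + snd q" by blast
    have lsep: "snd x + snd y \<le> \<bar>l * fst x - l * fst y\<bar>" if "i \<in> I" "x \<in> S i" "y \<in> S i" "x \<noteq> y" for i x y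
    proof -
      have "\<rho> x y \<in> E" using that by (rule E_I)
      then have "(snd x + snd y) / \<bar>fst x - fst y\<bar> \<le> l"
        unfolding l_def \<rho>_def[symmetric] using finE by (rule Max_ge[rotated])
      moreover have "0 < \<bar>fst x - fst y\<bar>" using sep[OF that] pos[OF that(1,2)] pos[OF that(1,3)] by linarith
      ultimately have "snd x + snd y \<le> l * \<bar>fst x - fst y\<bar>" by (simp add: pos_divide_le_eq)
      also have "\<dots> = \<bar>l * fst x - l * fst y\<bar>" using l by (simp add: abs_mult flip: right_diff_distrib)
      finally show ?thesis .
    qed
    define \<sigma> where "\<sigma> p = (l * fst p, snd p)" for p :: "real \<times> real"
    have inj: "inj_on \<sigma> (S i)" if "i \<in> I" for i
      using l by (auto simp: inj_on_def \<sigma>_def prod_eq_iff)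
    define S' where "S' i = \<sigma> ` S i" for i
    have sep': "separated (S' i)" if "i \<in> I" for i
      using fin[OF that] pos[OF that] lsep[OF that] by (auto simp: separated_def S'_def \<sigma>_def)
    have sum': "(\<Sum>p\<in>S' i. f p) = (\<Sum>p\<in>S i. f (\<sigma> p))" if "i \<in> I" for i and f :: "real \<times> real \<Rightarrow> 'c::comm_monoid_add"
      unfolding S'_def using inj[OF that] by (simp add: sum.reindex)
    have step': "interval_sum 1 (S' i) = interval_sum l (S i)" if "i \<in> I" for i
      using that by (auto simp: interval_sum_def sum' scaled_interval_def \<sigma>_def fun_eq_iff)
    have pq': "\<sigma> p \<in> S' i0" "\<sigma> q \<in> S' i0" "fst (\<sigma> q) = fst (\<sigma> p) + snd (\<sigma> p) + snd (\<sigma> q)"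
      using pq(1,2) pq(3) unfolding S'_def by (blast, blast, simp add: \<sigma>_def)
    note merge = merge_intervals[OF sep'[OF *(1)] pq']
    \<comment> \<open>Only one pair is merged. Other pairs in contact at \<open>l\<close> touch at
      factor 1 in the next round, which is why \<open>l = 1\<close> must be allowed.\<close>
    define T where "T = S'(i0 := insert (fst (\<sigma> p) + snd (\<sigma> q), snd (\<sigma> p) + snd (\<sigma> q)) (S' i0 - {\<sigma> p, \<sigma> q}))"
    have T: "separated (T i)" "interval_sum 1 (T i) = interval_sum l (S i)" "(\<Sum>x\<in>T i. snd x) = (\<Sum>x\<in>S i. snd x)"
      if "i \<in> I" for i
    proof -
      have "(\<Sum>x\<in>S' i. snd x) = (\<Sum>x\<in>S i. snd x)" using sum'[OF that, of snd] by (simp add: \<sigma>_def)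
      then show "separated (T i)" "interval_sum 1 (T i) = interval_sum l (S i)" "(\<Sum>x\<in>T i. snd x) = (\<Sum>x\<in>S i. snd x)"
        using merge(1-3) sep' step' that by (auto simp: T_def)
    qed
    have "card (S' i) = card (S i)" if "i \<in> I" for i
      unfolding S'_def using inj[OF that] by (rule card_image)
    then have card: "(\<Sum>i\<in>I. card (T i)) < (\<Sum>i\<in>I. card (S i))"
      using merge(4) *(1) finite_I by (intro sum_strict_mono_ex1 ballI bexI[of _ i0]) (auto simp: T_def)
    have "\<Phi> (\<lambda>i. interval_sum 1 (S i)) \<le> \<Phi> (\<lambda>i. interval_sum l (S i))"
      using fin l by (intro \<Phi>_interval_sum_slide) auto
    also have "\<dots> = \<Phi> (\<lambda>i. interval_sum 1 (T i))"
      unfolding \<Phi>_def by (intro nn_integral_cong prod.cong) (simp_all add: T(2))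
    also have "\<dots> \<le> \<Phi> (\<lambda>i. indicator {-1/2..1/2})"
      using less.hyps[OF card] T less.prems(2) by simp
    finally show ?thesis .
  qed
qed

end

section \<open>Reduction of densities to unions of intervals\<close>

text \<open>An open \<open>U\<close> around \<open>K\<close> still has measure at most 1. By
  compactness some mesh \<open>e\<close> keeps every cell that meets \<open>K\<close> inside
  \<open>U\<close>, so these disjoint cells have total length at most 1, that is, radii adding up to
  at most 1/2.\<close>

lemma grid_cover:
  assumes K: "compact K" "emeasure lborel K < 1"
  obtains S where "separated S" "(\<Sum>p\<in>S. snd p) \<le> 1 / 2" "\<And>y. indicator K y \<le> interval_sum 1 S y"
proof -
  have [measurable]: "K \<in> sets borel" using K by (rule_tac borel_compact)
  obtain k where k: "emeasure lborel K = ennreal k" "0 \<le> k" "k < 1"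
    using K(2) by (cases "emeasure lborel K") (auto simp: ennreal_less_one_iff)
  obtain U where U: "open U" "K \<subseteq> U" "emeasure lborel (U - K) < ennreal (1 - k)"
    using outer_regular_lborel[of K "1 - k"] k by auto
  have [measurable]: "U \<in> sets borel" using U by auto
  have "emeasure lborel U \<le> emeasure lborel K + emeasure lborel (U - K)"
    using emeasure_subadditive[of K lborel "U - K"] U(2) by (simp add: Un_absorb1)
  also have "\<dots> \<le> ennreal k + ennreal (1 - k)" using U(3) k by (intro add_mono) auto
  also have "\<dots> = 1" using k by (simp flip: ennreal_plus)
  finally have U1: "emeasure lborel U \<le> 1" .
  obtain e where e: "0 < e" "(\<Union>x\<in>K. ball x e) \<subseteq> U"
    using compact_subset_open_imp_ball_epsilon_subset[OF K(1) U(1,2)] by blast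
  define J where "J = (\<lambda>y. \<lfloor>y / e\<rfloor>) ` K"
  have "bounded K" using K(1) by (rule compact_imp_bounded)
  then obtain b where b: "\<And>y. y \<in> K \<Longrightarrow> \<bar>y\<bar> \<le> b" unfolding bounded_iff by auto
  have "J \<subseteq> {\<lfloor>- b / e\<rfloor>..\<lfloor>b / e\<rfloor>}"
  proof -
    have "- b / e \<le> y / e \<and> y / e \<le> b / e" if "y \<in> K" for y
      using b[OF that] e divide_right_mono[of "- b" y e] divide_right_mono[of y b e] by auto
    then show ?thesis by (auto simp: J_def intro!: floor_mono)
  qed
  then have finJ: "finite J" by (rule finite_subset) simp
  \<comment> \<open>Centre and radius of the cell from \<open>j * e\<close> to
    \<open>(j + 1) * e\<close>; half-open cells tile the line.\<close>
  define \<sigma> where "\<sigma> j = ((of_int j + 1 / 2) * e, e / 2)" for j :: int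
  define S where "S = \<sigma> ` J"
  have inj: "inj_on \<sigma> J" using e by (auto simp: inj_on_def \<sigma>_def)
  have cell: "y \<in> scaled_interval 1 (\<sigma> j) \<longleftrightarrow> \<lfloor>y / e\<rfloor> = j" for y j
    using e by (auto simp: scaled_interval_def \<sigma>_def floor_eq_iff field_simps)
  show thesis
  proof (rule that[of S])
    have "e / 2 + e / 2 \<le> \<bar>(of_int j + 1 / 2) * e - (of_int j' + 1 / 2) * e\<bar>" if "j \<noteq> j'" for j j' :: int
    proof -
      have "1 \<le> \<bar>of_int j - of_int j' :: real\<bar>" using that by linarith
      then have "1 * e \<le> \<bar>of_int j - of_int j' :: real\<bar> * e" using e by (intro mult_right_mono) auto
      also have "\<dots> = \<bar>(of_int j - of_int j') * e\<bar>" using e by (simp add: abs_mult)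
      finally show ?thesis by (simp add: algebra_simps)
    qed
    then show "separated S" using finJ e by (auto simp: separated_def S_def \<sigma>_def)
    have "ennreal (\<Sum>p\<in>S. 2 * snd p) = (\<Sum>j\<in>J. emeasure lborel (scaled_interval 1 (\<sigma> j)))"
      unfolding S_def sum.reindex[OF inj] using e
      by (subst sum_ennreal[symmetric]) (auto simp: \<sigma>_def scaled_interval_def)
    also have "\<dots> = emeasure lborel (\<Union>j\<in>J. scaled_interval 1 (\<sigma> j))"
    proof (rule sum_emeasure)
      show "disjoint_family_on (\<lambda>j. scaled_interval 1 (\<sigma> j)) J"
        by (auto simp: disjoint_family_on_def) (metis cell)
    qed (use finJ in \<open>auto simp: scaled_interval_def\<close>)
    also have "\<dots> \<le> emeasure lborel U"
    proof (rule emeasure_mono)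
      show "(\<Union>j\<in>J. scaled_interval 1 (\<sigma> j)) \<subseteq> U"
      proof safe
        fix y j assume "j \<in> J" "y \<in> scaled_interval 1 (\<sigma> j)"
        then obtain x where x: "x \<in> K" "\<lfloor>x / e\<rfloor> = \<lfloor>y / e\<rfloor>" by (auto simp: cell J_def)
        then have "\<bar>x / e - y / e\<bar> < 1" by linarith
        then have "dist x y < e" using e by (auto simp: dist_real_def field_simps simp flip: diff_divide_distrib)
        then have "y \<in> ball x e" by simp
        with x(1) show "y \<in> U" using e(2) by blast
      qed
    qed simp
    also note U1
    finally have "(\<Sum>p\<in>S. 2 * snd p) \<le> 1" by (simp add: ennreal_le_1)
    then show "(\<Sum>p\<in>S. snd p) \<le> 1 / 2" by (simp flip: sum_distrib_left)
    show "indicator K y \<le> interval_sum 1 S y" for y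
    proof (cases "y \<in> K")
      case True
      then have j: "\<lfloor>y / e\<rfloor> \<in> J" by (auto simp: J_def)
      have "indicator K y = (indicator (scaled_interval 1 (\<sigma> \<lfloor>y / e\<rfloor>)) y :: ennreal)" using True by (simp add: cell)
      also have "\<dots> \<le> interval_sum 1 S y"
        unfolding interval_sum_def using finJ j by (intro member_le_sum) (auto simp: S_def)
      finally show ?thesis .
    qed simp
  qed
qed

text \<open>Intermediate value theorem for the measure of \<open>D \<inter> {-s..s}\<close>:
  enlarging \<open>s\<close> to \<open>s'\<close> adds at most two intervals of length
  \<open>s' - s\<close>, so this function of \<open>s\<close> is Lipschitz with constant 2.\<close>

lemma exists_subset_of_measure:
  fixes D :: "real set"
  assumes [measurable]: "D \<in> sets borel" and fin: "emeasure lborel D < \<infinity>" and d: "0 \<le> d" "ennreal d \<le> emeasure lborel D"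
  obtains D' where "D' \<subseteq> D" "D' \<in> sets borel" "emeasure lborel D' = ennreal d"
proof (cases "ennreal d = emeasure lborel D")
  case True
  then show ?thesis using that[of D] by simp
next
  case False
  define F where "F s = measure lborel (D \<inter> {-s..s})" for s
  have finS: "emeasure lborel (D \<inter> {-s..s}) < \<infinity>" for s
    using emeasure_mono[of "D \<inter> {-s..s}" D lborel] fin by (auto intro: le_less_trans)
  have F: "emeasure lborel (D \<inter> {-s..s}) = ennreal (F s)" for s
    using finS[of s] unfolding F_def by (intro emeasure_eq_ennreal_measure) auto
  have "(SUP n. emeasure lborel (D \<inter> {-real n..real n})) = emeasure lborel (\<Union>n. D \<inter> {-real n..real n})"
    by (intro SUP_emeasure_incseq) (auto simp: incseq_def)
  moreover have "(\<Union>n. D \<inter> {-real n..real n}) = D"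
  proof -
    have "\<exists>n. x \<in> {-real n..real n}" for x :: real
    proof -
      obtain n where "\<bar>x\<bar> \<le> real n" using real_arch_simple[of "\<bar>x\<bar>"] ..
      then show ?thesis by (intro exI[of _ n]) (simp add: abs_le_iff)
    qed
    then show ?thesis by blast
  qed
  ultimately have "ennreal d < (SUP n. emeasure lborel (D \<inter> {-real n..real n}))" using d False by simp
  then obtain n where "ennreal d < emeasure lborel (D \<inter> {-real n..real n})" unfolding less_SUP_iff by blast
  then have n: "d < F (real n)" using F[of "real n"] d by (simp add: ennreal_less_iff)
  have mono: "F s \<le> F s'" "F s' - F s \<le> 2 * (s' - s)" if "0 \<le> s" "s \<le> s'" for s s'
  proof -
    have "ennreal (F s) \<le> ennreal (F s')" unfolding F[symmetric] using that by (intro emeasure_mono) auto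
    then show "F s \<le> F s'" by (simp add: F_def)
    have "ennreal (F s') \<le> emeasure lborel ((D \<inter> {-s..s}) \<union> ({-s'..-s} \<union> {s..s'}))"
      unfolding F[symmetric] by (intro emeasure_mono) auto
    also have "\<dots> \<le> emeasure lborel (D \<inter> {-s..s}) + emeasure lborel ({-s'..-s} \<union> {s..s'})"
      by (intro emeasure_subadditive) auto
    also have "\<dots> \<le> emeasure lborel (D \<inter> {-s..s}) + (emeasure lborel {-s'..-s} + emeasure lborel {s..s'})"
      by (intro add_left_mono emeasure_subadditive) auto
    also have "\<dots> = ennreal (F s + 2 * (s' - s))"
      using that by (simp add: F F_def flip: ennreal_plus)
    finally show "F s' - F s \<le> 2 * (s' - s)" using that by (subst (asm) ennreal_le_iff) (auto simp: F_def)
  qed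
  have "continuous_on {0..real n} F"
  proof (rule lipschitz_on_continuous_on[OF lipschitz_onI[of _ _ 2]])
    fix s s' assume "s \<in> {0..real n}" "s' \<in> {0..real n}"
    then show "dist (F s) (F s') \<le> 2 * dist s s'"
      using mono[of s s'] mono[of s' s] by (cases "s \<le> s'") (auto simp: dist_real_def)
  qed simp
  moreover have "F 0 = 0"
    using emeasure_mono[of "D \<inter> {0}" "{0}" lborel] F[of 0] by (simp add: F_def)
  ultimately obtain s where s: "0 \<le> s" "F s = d"
    using IVT'[of F 0 d "real n"] n d by auto
  then show ?thesis using that[of "D \<inter> {-s..s}"] F by auto
qed

text \<open>The set is a superlevel set of the weight, completed by a part of the level set.\<close>

lemma bathtub:
  fixes w g :: "real \<Rightarrow> ennreal"
  assumes [measurable]: "w \<in> borel_measurable borel" "g \<in> borel_measurable borel"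
    and w: "(\<integral>\<^sup>+x. w x \<partial>lborel) < \<infinity>" and g: "\<And>x. g x \<le> 1" "(\<integral>\<^sup>+x. g x \<partial>lborel) \<le> ennreal m"
    and m: "0 \<le> m"
  obtains A where "A \<in> sets borel" "emeasure lborel A \<le> ennreal m"
    "(\<integral>\<^sup>+x. g x * w x \<partial>lborel) \<le> (\<integral>\<^sup>+x\<in>A. w x \<partial>lborel)"
proof -
  define T where "T = {t. emeasure lborel {x. t < w x} \<le> ennreal m}"
  have "top \<in> T" by (simp add: T_def)
  then have "T \<noteq> {}" by auto
  define \<tau> where "\<tau> = Inf T"
  define L where "L = {x. \<tau> < w x}"
  have [measurable]: "L \<in> sets borel" by (simp add: L_def)
  \<comment> \<open>The infimum \<tau> is itself an admissible threshold: along thresholds in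
    \<open>T\<close> decreasing to \<tau>, the superlevel sets increase to \<open>L\<close>.\<close>
  have L: "emeasure lborel L \<le> ennreal m"
  proof -
    obtain f where f: "decseq f" "range f \<subseteq> T" "\<tau> = (INF i. f i)"
      using ennreal_Inf_countable_INF[OF \<open>T \<noteq> {}\<close>] unfolding \<tau>_def by metis
    have "L = (\<Union>n. {x. f n < w x})" by (auto simp: L_def f(3) INF_less_iff)
    also have "emeasure lborel \<dots> = (SUP n. emeasure lborel {x. f n < w x})"
      using f(1) by (intro SUP_emeasure_incseq[symmetric]) (auto simp: incseq_def decseq_def intro: le_less_trans)
    also have "\<dots> \<le> ennreal m" using f(2) by (intro SUP_least) (auto simp: T_def)
    finally show ?thesis .
  qed
  show thesis
  proof (cases "\<tau> = 0")
    case True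
    \<comment> \<open>At threshold 0 the set \<open>L\<close> already carries all of
      \<open>w\<close>.\<close>
    have "(\<integral>\<^sup>+x. g x * w x \<partial>lborel) \<le> (\<integral>\<^sup>+x\<in>L. w x \<partial>lborel)"
    proof (rule nn_integral_mono)
      fix x
      have "g x * w x \<le> 1 * w x" using g(1) by (intro mult_right_mono) auto
      then show "g x * w x \<le> w x * indicator L x"
        using True by (auto simp: L_def indicator_def zero_less_iff_neq_zero)
    qed
    with that[of L] L show thesis by simp
  next
    case False
    then have \<tau>0: "0 < \<tau>" by (simp add: zero_less_iff_neq_zero)
    \<comment> \<open>Finiteness of the superlevel sets permits continuity from above in the next
      estimate.\<close>
    have markov: "emeasure lborel {x. t \<le> w x} < \<infinity>" if "0 < t" for t
    proof (cases "t = top")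
      case True
      then have "{x. t \<le> w x} = {x\<in>space lborel. w x = \<infinity>}" by (auto simp: top_unique)
      then show ?thesis using nn_integral_PInf[of w lborel] w by (simp add: vimage_def)
    next
      case False
      with that obtain r where r: "t = ennreal r" "0 < r"
        by (cases t) auto
      have "{x. t \<le> w x} \<subseteq> {x\<in>UNIV. 1 \<le> ennreal (1 / r) * w x}"
      proof safe
        fix x assume "t \<le> w x"
        then have "ennreal (1 / r) * t \<le> ennreal (1 / r) * w x" by (rule mult_left_mono) simp
        then show "1 \<le> ennreal (1 / r) * w x" using r by (simp flip: ennreal_mult)
      qed simp
      then have "emeasure lborel {x. t \<le> w x} \<le> emeasure lborel {x\<in>UNIV. 1 \<le> ennreal (1 / r) * w x}"
        by (intro emeasure_mono) auto
      also have "\<dots> \<le> ennreal (1 / r) * (\<integral>\<^sup>+x. w x * indicator UNIV x \<partial>lborel)"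
        by (rule nn_integral_Markov_inequality) auto
      also have "\<dots> < \<infinity>" using w by (auto simp: ennreal_mult_less_top)
      finally show ?thesis .
    qed
    define D where "D = {x. w x = \<tau>}"
    have [measurable]: "D \<in> sets borel" by (simp add: D_def)
    have LD: "L \<union> D = {x. \<tau> \<le> w x}" "L \<inter> D = {}" by (auto simp: L_def D_def)
    \<comment> \<open>Heights below \<tau> are not in \<open>T\<close>, so their superlevel sets
      have measure above \<open>m\<close>; as the heights increase to \<tau>, the closed superlevel
      sets decrease to \<open>L \<union> D\<close>.\<close>
    have "ennreal m \<le> emeasure lborel (L \<union> D)"
    proof -
      have ne: "{0<..<\<tau>} \<noteq> {}" using dense[OF \<tau>0] by auto
      obtain f where f: "incseq f" "range f \<subseteq> {0<..<\<tau>}" "Sup {0<..<\<tau>} = (SUP i. f i)"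
        using ennreal_Sup_countable_SUP[OF ne] by metis
      have "Sup {0<..<\<tau>} = \<tau>" using \<tau>0 by (rule cSup_greaterThanLessThan)
      then have f3: "\<tau> = (SUP i. f i)" using f(3) by simp
      have "f n \<in> {0<..<\<tau>}" for n using f(2) by blast
      then have fn: "0 < f n" "f n < \<tau>" for n by auto
      have "L \<union> D = (\<Inter>n. {x. f n \<le> w x})" unfolding LD f3 by (auto simp: SUP_le_iff)
      also have "emeasure lborel \<dots> = (INF n. emeasure lborel {x. f n \<le> w x})"
        using f(1) less_imp_neq[OF markov[OF fn(1)]]
        by (intro INF_emeasure_decseq[symmetric]) (auto simp: incseq_def decseq_def intro: order_trans)
      also have "\<dots> \<ge> ennreal m"
      proof (rule INF_greatest)
        fix n
        have "f n \<notin> T" using fn(2)[of n] unfolding \<tau>_def by (meson Inf_lower leD)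
        then have "ennreal m \<le> emeasure lborel {x. f n < w x}" by (simp add: T_def)
        also have "\<dots> \<le> emeasure lborel {x. f n \<le> w x}" by (intro emeasure_mono) auto
        finally show "ennreal m \<le> emeasure lborel {x. f n \<le> w x}" .
      qed
      finally show ?thesis .
    qed
    then have mLD: "ennreal m \<le> emeasure lborel L + emeasure lborel D"
      using LD(2) by (simp add: plus_emeasure)
    have "emeasure lborel L < \<infinity>" using L by (auto intro: le_less_trans)
    then obtain a where a: "emeasure lborel L = ennreal a" "0 \<le> a" by (cases "emeasure lborel L") auto
    have am: "a \<le> m" using L a m by simp
    have D: "emeasure lborel D < \<infinity>"
      using emeasure_mono[of D "L \<union> D" lborel] markov[OF \<tau>0] LD(1) by (auto intro: le_less_trans)
    then obtain d where d: "emeasure lborel D = ennreal d" "0 \<le> d" by (cases "emeasure lborel D") auto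
    have "ennreal (m - a) \<le> emeasure lborel D"
      using mLD a d by (simp flip: ennreal_plus)
    then obtain D' where D': "D' \<subseteq> D" "D' \<in> sets borel" "emeasure lborel D' = ennreal (m - a)"
      using exists_subset_of_measure[of D "m - a"] D am by auto
    define A where "A = L \<union> D'"
    have [measurable]: "D' \<in> sets borel" "A \<in> sets borel" using D' by (auto simp: A_def)
    have "emeasure lborel A = emeasure lborel L + emeasure lborel D'"
      unfolding A_def using D'(1) LD(2) by (intro plus_emeasure[symmetric]) auto
    also have "\<dots> = ennreal m" using a D'(3) am by (simp flip: ennreal_plus)
    finally have Am: "emeasure lborel A = ennreal m" .
    have A: "\<And>x. x \<in> A \<Longrightarrow> \<tau> \<le> w x" "\<And>x. x \<notin> A \<Longrightarrow> w x \<le> \<tau>"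
      using D'(1) by (auto simp: A_def L_def D_def)
    let ?in = "\<integral>\<^sup>+x\<in>A. g x \<partial>lborel" and ?out = "\<integral>\<^sup>+x\<in>-A. g x \<partial>lborel" and ?co = "\<integral>\<^sup>+x\<in>A. (1 - g x) \<partial>lborel"
    have split: "(\<integral>\<^sup>+x. h x \<partial>lborel) = (\<integral>\<^sup>+x\<in>A. h x \<partial>lborel) + (\<integral>\<^sup>+x\<in>-A. h x \<partial>lborel)"
      if [measurable]: "h \<in> borel_measurable borel" for h :: "real \<Rightarrow> ennreal"
      by (subst nn_integral_add[symmetric]) (auto intro!: nn_integral_cong simp: indicator_def)
    have one: "g x + (1 - g x) = 1" for x using g(1)[of x] by (simp add: add_diff_inverse_ennreal)
    have "?in + ?out \<le> ennreal m" using g(2) split[of g] by simp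
    also have "ennreal m = (\<integral>\<^sup>+x. indicator A x \<partial>lborel)" using Am by simp
    also have "\<dots> = ?in + ?co"
      by (subst nn_integral_add[symmetric]) (auto intro!: nn_integral_cong simp: one simp flip: distrib_right)
    finally have "?in + ?out \<le> ?in + ?co" .
    moreover have "?in \<noteq> top"
    proof -
      have "?in \<le> (\<integral>\<^sup>+x. g x \<partial>lborel)" by (intro nn_integral_mono) (auto simp: indicator_def)
      also have "\<dots> < top" using g(2) by (auto intro: le_less_trans)
      finally show ?thesis by simp
    qed
    ultimately have out: "?out \<le> ?co" by (simp add: ennreal_add_left_cancel_le)
    have "(\<integral>\<^sup>+x. g x * w x \<partial>lborel) = (\<integral>\<^sup>+x\<in>A. (g x * w x) \<partial>lborel) + (\<integral>\<^sup>+x\<in>-A. (g x * w x) \<partial>lborel)"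
      by (rule split) measurable
    \<comment> \<open>The mass \<open>?out\<close> of \<open>g\<close> outside \<open>A\<close> is
      at most the deficit \<open>?co\<close> inside. Since \<open>w\<close> is at most \<tau>
      outside and at least \<tau> inside, moving that mass into \<open>A\<close> does not lower the
      weighted integral.\<close>
    also have "(\<integral>\<^sup>+x\<in>-A. (g x * w x) \<partial>lborel) \<le> (\<integral>\<^sup>+x. \<tau> * (g x * indicator (-A) x) \<partial>lborel)"
      using mult_left_mono[OF A(2), of _ "g _"]
      by (intro nn_integral_mono) (auto simp: indicator_def mult.commute[of \<tau>])
    also have "\<dots> = \<tau> * ?out" by (rule nn_integral_cmult) measurable
    also have "\<dots> \<le> \<tau> * ?co" by (intro mult_left_mono out) simp
    also have "\<dots> = (\<integral>\<^sup>+x. \<tau> * ((1 - g x) * indicator A x) \<partial>lborel)" by (rule nn_integral_cmult[symmetric]) measurable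
    also have "\<dots> \<le> (\<integral>\<^sup>+x\<in>A. ((1 - g x) * w x) \<partial>lborel)"
      using mult_left_mono[OF A(1), of _ "1 - g _"]
      by (intro nn_integral_mono) (auto simp: indicator_def mult.commute[of \<tau>])
    also have "(\<integral>\<^sup>+x\<in>A. (g x * w x) \<partial>lborel) + (\<integral>\<^sup>+x\<in>A. ((1 - g x) * w x) \<partial>lborel) = (\<integral>\<^sup>+x\<in>A. w x \<partial>lborel)"
      by (subst nn_integral_add[symmetric])
        (auto intro!: nn_integral_cong simp: one simp flip: distrib_right)
    finally have "(\<integral>\<^sup>+x. g x * w x \<partial>lborel) \<le> (\<integral>\<^sup>+x\<in>A. w x \<partial>lborel)" by (simp add: add_left_mono)
    with that[of A] Am show thesis by simp
  qed
qed

text \<open>The Radon-Nikodym density of \<nu> is the weight of the bathtub argument, which yields a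
  set of length at most \<open>m\<close>. A compact subset still has \<nu>-measure above
  \<open>c\<close>, and \<open>m < 1\<close> leaves room to cover it by a grid.\<close>

lemma exists_interval_sum_greater:
  fixes \<nu> :: "real measure" and g :: "real \<Rightarrow> ennreal"
  assumes sets: "sets \<nu> = sets borel" and fin: "emeasure \<nu> (space \<nu>) < \<infinity>"
    and ac: "absolutely_continuous lborel \<nu>"
    and [measurable]: "g \<in> borel_measurable borel" and g: "\<And>x. g x \<le> 1" "(\<integral>\<^sup>+x. g x \<partial>lborel) \<le> ennreal m"
    and m: "0 \<le> m" "m < 1" and c: "c < (\<integral>\<^sup>+x. g x \<partial>\<nu>)"
  obtains S where "separated S" "(\<Sum>p\<in>S. snd p) \<le> 1 / 2" "c < (\<integral>\<^sup>+x. interval_sum 1 S x \<partial>\<nu>)"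
proof -
  obtain w where w: "w \<in> borel_measurable lborel" "density lborel w = \<nu>"
    using sigma_finite_measure.Radon_Nikodym[OF sigma_finite_lborel ac] sets by auto
  have [measurable]: "w \<in> borel_measurable borel" using w by simp
  have \<nu>: "emeasure \<nu> A = (\<integral>\<^sup>+x\<in>A. w x \<partial>lborel)" if "A \<in> sets borel" for A
    using that by (simp add: w(2)[symmetric] emeasure_density)
  have "space \<nu> = UNIV" using sets_eq_imp_space_eq[OF sets] by simp
  then have "(\<integral>\<^sup>+x. w x \<partial>lborel) < \<infinity>" using fin \<nu>[of UNIV] by simp
  then obtain A where A: "A \<in> sets borel" "emeasure lborel A \<le> ennreal m"
    "(\<integral>\<^sup>+x. g x * w x \<partial>lborel) \<le> (\<integral>\<^sup>+x\<in>A. w x \<partial>lborel)"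
    using bathtub[of w g m] g m by (auto simp del: infinity_ennreal_def)
  have "(\<integral>\<^sup>+x. g x \<partial>\<nu>) = (\<integral>\<^sup>+x. g x * w x \<partial>lborel)"
    by (simp add: w(2)[symmetric] nn_integral_density mult.commute)
  with A c have "c < emeasure \<nu> A" by (simp add: \<nu>)
  also have "emeasure \<nu> A = (SUP K\<in>{K. K \<subseteq> A \<and> compact K}. emeasure \<nu> K)"
    using sets fin A(1) by (intro inner_regular) auto
  finally obtain K where K: "K \<subseteq> A" "compact K" "c < emeasure \<nu> K"
    unfolding less_SUP_iff by blast
  have [measurable]: "K \<in> sets borel" using K(2) by (rule borel_compact)
  have "emeasure lborel K \<le> emeasure lborel A" using K A by (intro emeasure_mono) auto
  also have "\<dots> \<le> ennreal m" by (rule A)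
  also have "\<dots> < 1" using m by (simp add: ennreal_less_one_iff)
  finally obtain S where S: "separated S" "(\<Sum>p\<in>S. snd p) \<le> 1 / 2" "\<And>y. indicator K y \<le> interval_sum 1 S y"
    using grid_cover[OF K(2)] by metis
  have "emeasure \<nu> K = (\<integral>\<^sup>+x. indicator K x \<partial>\<nu>)" using sets by (intro nn_integral_indicator[symmetric]) simp
  also have "\<dots> \<le> (\<integral>\<^sup>+x. interval_sum 1 S x \<partial>\<nu>)" by (intro nn_integral_mono S)
  finally show thesis using that[OF S(1,2)] K(3) by auto
qed

lemma measurable_interval_sum [measurable]: "interval_sum l S \<in> borel_measurable borel"
  unfolding interval_sum_def[abs_def] scaled_interval_def by measurable

text \<open>The limit \<theta> to 1 from below. The power appears because scaling each of
  \<open>k\<close> factors by \<theta> scales a multilinear functional by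
  \<open>\<theta> ^ k\<close>.\<close>

lemma ennreal_le_of_power_mult_le:
  fixes X C :: ennreal
  assumes *: "\<And>\<theta>. 0 < \<theta> \<Longrightarrow> \<theta> < 1 \<Longrightarrow> ennreal (\<theta> ^ k) * X \<le> C"
  shows "X \<le> C"
proof (cases "C = top")
  case False
  then obtain c where c: "C = ennreal c" "0 \<le> c" by (cases C) auto
  have "X \<noteq> top"
  proof
    assume "X = top"
    then have "ennreal ((1 / 2) ^ k) * X = top" by (simp add: ennreal_mult_top)
    with *[of "1 / 2"] False show False by (simp add: top_unique)
  qed
  then obtain x where x: "X = ennreal x" "0 \<le> x" by (cases X) auto
  have "((\<lambda>\<theta>. \<theta> ^ k * x) \<longlongrightarrow> 1 ^ k * x) (at_left 1)" by (intro tendsto_intros)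
  moreover have "eventually (\<lambda>\<theta>. \<theta> ^ k * x \<le> c) (at_left (1::real))"
    unfolding eventually_at_left_field
  proof (intro exI[of _ 0] conjI allI impI)
    fix \<theta> :: real assume "0 < \<theta>" "\<theta> < 1"
    with *[of \<theta>] x c show "\<theta> ^ k * x \<le> c" by (simp flip: ennreal_mult)
  qed simp
  ultimately have "1 ^ k * x \<le> c" by (rule tendsto_upperbound) simp
  with x c show ?thesis by simp
qed simp

section \<open>Replacing the factors of the functional by unions of intervals\<close>

context linear_forms
begin

lemma sigma_finite_P: "sigma_finite_measure P"
proof -
  interpret finite_product_sigma_finite "\<lambda>_. lborel :: real measure" B by standard (rule finite_B)
  show ?thesis unfolding P_def by (rule sigma_finite_measure_axioms)
qed

lemma AE_form_notin_null_set:
  assumes "i \<in> I" "N \<in> null_sets lborel"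
  shows "AE x in P. form i x \<notin> N"
proof -
  obtain b where "b \<in> B" "u i b \<noteq> 0" using nonzero[OF assms(1)] by blast
  then show ?thesis
    unfolding P_def form_def by (intro AE_PiM_linear_form_notin_null_set finite_B assms)
qed

text \<open>With the other factors frozen, the functional is the integral of \<open>f i\<close>
  against the image under \<open>form i\<close> of the measure with density \<open>W\<close>. This
  measure may be infinite, so \<open>W\<close> is first cut down without losing the strict
  bound.\<close>

lemma exists_interval_sum_\<Phi>_greater:
  assumes i: "i \<in> I" and f[measurable]: "\<And>j. j \<in> I \<Longrightarrow> f j \<in> borel_measurable borel"
    and g: "\<And>x. f i x \<le> 1" "(\<integral>\<^sup>+x. f i x \<partial>lborel) \<le> ennreal m"
    and m: "0 \<le> m" "m < 1" and c: "c < \<Phi> f"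
  obtains S where "separated S" "(\<Sum>p\<in>S. snd p) \<le> 1 / 2" "c < \<Phi> (f(i := interval_sum 1 S))"
proof -
  have [measurable]: "f i \<in> borel_measurable borel" using i f by blast
  obtain h where h: "h \<in> borel_measurable P" "integral\<^sup>N P h \<noteq> \<infinity>" "\<And>x. x \<in> space P \<Longrightarrow> 0 < h x"
    using sigma_finite_measure.Ex_finite_integrable_function[OF sigma_finite_P] by metis
  note [measurable] = h(1)
  define W where "W x = (\<Prod>j\<in>I - {i}. f j (form j x))" for x
  have [measurable]: "W \<in> borel_measurable P" unfolding W_def[abs_def] by measurable
  \<comment> \<open>As \<open>h\<close> is positive and integrable, each \<open>W' n\<close> is
    integrable, and they increase to \<open>W\<close> even where \<open>W\<close> is
    infinite.\<close>
  define W' where "W' n x = min (W x) (of_nat n * h x)" for n :: nat and x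
  have [measurable]: "W' n \<in> borel_measurable P" for n unfolding W'_def[abs_def] by measurable
  have \<Phi>_eq: "\<Phi> (f(i := k)) = (\<integral>\<^sup>+x. k (form i x) * W x \<partial>P)" for k
    unfolding \<Phi>_def W_def using i finite_I by (intro nn_integral_cong) (auto simp: prod.remove intro!: prod.cong)
  have SUP_W': "(SUP n. W' n x) = W x" if x: "x \<in> space P" for x
  proof (rule antisym)
    have "(SUP n. of_nat n * h x) = top"
      using h(3)[OF x] by (simp add: SUP_mult_right_ennreal[symmetric] ennreal_SUP_of_nat_eq_top ennreal_top_mult)
    then have top: "top = (SUP n. of_nat n * h x)" by (rule sym)
    show "W x \<le> (SUP n. W' n x)"
    proof (rule dense_le)
      fix v assume v: "v < W x"
      then have "v < top" using top.not_eq_extremum by fastforce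
      then obtain n where "v < of_nat n * h x" unfolding top less_SUP_iff by blast
      with v show "v \<le> (SUP n. W' n x)" by (intro SUP_upper2[of n]) (auto simp: W'_def)
    qed
  qed (auto intro: SUP_least simp: W'_def)
  have "\<Phi> f = (\<integral>\<^sup>+x. (SUP n. f i (form i x) * W' n x) \<partial>P)"
    using \<Phi>_eq[of "f i"] by (auto intro!: nn_integral_cong simp: SUP_W' simp flip: SUP_mult_left_ennreal)
  also have "\<dots> = (SUP n. \<integral>\<^sup>+x. f i (form i x) * W' n x \<partial>P)"
    by (intro nn_integral_monotone_convergence_SUP)
      (auto simp: incseq_def le_fun_def W'_def intro!: mult_left_mono min.mono mult_right_mono)
  finally have "c < (SUP n. \<integral>\<^sup>+x. f i (form i x) * W' n x \<partial>P)" using c by simp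
  then obtain n where n: "c < (\<integral>\<^sup>+x. f i (form i x) * W' n x \<partial>P)"
    unfolding less_SUP_iff by blast
  define \<nu> where "\<nu> = distr (density P (W' n)) borel (form i)"
  have int: "(\<integral>\<^sup>+y. k y \<partial>\<nu>) = (\<integral>\<^sup>+x. k (form i x) * W' n x \<partial>P)" if "k \<in> borel_measurable borel" for k
    using that by (simp add: \<nu>_def nn_integral_distr nn_integral_density mult.commute)
  have sets: "sets \<nu> = sets borel" by (simp add: \<nu>_def)
  have "emeasure \<nu> (space \<nu>) = (\<integral>\<^sup>+x. W' n x \<partial>P)"
    using int[of "\<lambda>_. 1"] by simp
  also have "\<dots> \<le> (\<integral>\<^sup>+x. of_nat n * h x \<partial>P)" by (intro nn_integral_mono) (simp add: W'_def)
  also have "\<dots> < \<infinity>" using h(2) by (simp add: nn_integral_cmult ennreal_mult_less_top less_top of_nat_less_top)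
  finally have fin: "emeasure \<nu> (space \<nu>) < \<infinity>" .
  have ac: "absolutely_continuous lborel \<nu>"
    unfolding absolutely_continuous_def
  proof
    fix N :: "real set" assume N: "N \<in> null_sets lborel"
    then have [measurable]: "N \<in> sets borel" by auto
    have "emeasure \<nu> N = (\<integral>\<^sup>+y. indicator N y \<partial>\<nu>)" using sets by simp
    also have "\<dots> = (\<integral>\<^sup>+x. indicator N (form i x) * W' n x \<partial>P)" by (rule int) measurable
    also have "\<dots> = (\<integral>\<^sup>+x. 0 \<partial>P)"
      using AE_form_notin_null_set[OF i N] by (intro nn_integral_cong_AE) (auto elim!: eventually_mono)
    finally show "N \<in> null_sets \<nu>" using sets by (auto simp: null_sets_def)
  qed
  obtain S where S: "separated S" "(\<Sum>p\<in>S. snd p) \<le> 1 / 2" "c < (\<integral>\<^sup>+x. interval_sum 1 S x \<partial>\<nu>)"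
    using exists_interval_sum_greater[OF sets fin ac _ g m, of c] n by (auto simp: int)
  note S(3)
  also have "(\<integral>\<^sup>+x. interval_sum 1 S x \<partial>\<nu>) = (\<integral>\<^sup>+x. interval_sum 1 S (form i x) * W' n x \<partial>P)"
    by (rule int) measurable
  also have "\<dots> \<le> \<Phi> (f(i := interval_sum 1 S))"
    unfolding \<Phi>_eq by (intro nn_integral_mono mult_left_mono) (auto simp: W'_def)
  finally show thesis using that S by blast
qed

text \<open>Induction on the set \<open>J\<close> of indices that still carry their original
  function; all others carry interval sums already, and for empty \<open>J\<close> the sliding
  argument applies. Each replacement preserves a chosen strict lower bound \<open>c\<close>
  only.\<close>

lemma \<Phi>_le_of_mass_less_one:
  assumes f: "\<And>i. i \<in> I \<Longrightarrow> f i \<in> borel_measurable borel" "\<And>i y. i \<in> I \<Longrightarrow> f i y \<le> 1"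
      "\<And>i. i \<in> I \<Longrightarrow> (\<integral>\<^sup>+y. f i y \<partial>lborel) \<le> ennreal m"
    and m: "0 \<le> m" "m < 1"
  shows "\<Phi> f \<le> \<Phi> (\<lambda>i. indicator {-1/2..1/2})"
proof -
  have "\<Phi> h \<le> \<Phi> (\<lambda>i. indicator {-1/2..1/2})"
    if "finite J" "J \<subseteq> I" "\<And>i. i \<in> J \<Longrightarrow> h i = f i"
      "\<And>i. i \<in> I - J \<Longrightarrow> \<exists>S. separated S \<and> (\<Sum>p\<in>S. snd p) \<le> 1 / 2 \<and> h i = interval_sum 1 S" for J h
    using that
  proof (induction J arbitrary: h rule: finite_induct)
    case empty
    then obtain S where S: "\<And>i. i \<in> I \<Longrightarrow> separated (S i) \<and> (\<Sum>p\<in>S i. snd p) \<le> 1 / 2 \<and> h i = interval_sum 1 (S i)"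
      by (simp add: Bex_def) metis
    have "\<Phi> h = \<Phi> (\<lambda>i. interval_sum 1 (S i))"
      unfolding \<Phi>_def using S by (intro nn_integral_cong prod.cong) auto
    also have "\<dots> \<le> \<Phi> (\<lambda>i. indicator {-1/2..1/2})" using S by (intro \<Phi>_separated_le) auto
    finally show ?case .
  next
    case (insert i J)
    have i: "i \<in> I" using insert.prems by auto
    have hi: "h i = f i" using insert.prems by auto
    have meas: "h j \<in> borel_measurable borel" if "j \<in> I" for j
      using insert.prems(2)[of j] insert.prems(3)[of j] f(1)[OF that] that
      by (cases "j \<in> insert i J") auto
    show ?case
    proof (rule dense_le)
      fix c assume c: "c < \<Phi> h"
      obtain S where S: "separated S" "(\<Sum>p\<in>S. snd p) \<le> 1 / 2" "c < \<Phi> (h(i := interval_sum 1 S))"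
        using exists_interval_sum_\<Phi>_greater[OF i meas _ _ m c] f(2,3)[OF i] hi by auto
      have "\<Phi> (h(i := interval_sum 1 S)) \<le> \<Phi> (\<lambda>i. indicator {-1/2..1/2})"
      proof (rule insert.IH)
        fix j assume j: "j \<in> I - J"
        show "\<exists>T. separated T \<and> (\<Sum>p\<in>T. snd p) \<le> 1 / 2 \<and> (h(i := interval_sum 1 S)) j = interval_sum 1 T"
        proof (cases "j = i")
          case True
          then show ?thesis using S by auto
        next
          case False
          then show ?thesis using j insert.prems(3)[of j] by auto
        qed
      qed (use insert.prems insert.hyps in auto)
      with S(3) show "c \<le> \<Phi> (\<lambda>i. indicator {-1/2..1/2})" by auto
    qed
  qed
  from this[of I f] show ?thesis using finite_I by auto
qed

text \<open>Multiplying every factor by \<theta> creates the spare length that the grid needs, at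
  the cost of a factor \<open>\<theta> ^ card I\<close>, which tends to 1.\<close>

theorem \<Phi>_le_cube:
  assumes f: "\<And>i. i \<in> I \<Longrightarrow> f i \<in> borel_measurable borel" "\<And>i y. i \<in> I \<Longrightarrow> f i y \<le> 1"
      "\<And>i. i \<in> I \<Longrightarrow> (\<integral>\<^sup>+y. f i y \<partial>lborel) \<le> 1"
  shows "\<Phi> f \<le> \<Phi> (\<lambda>i. indicator {-1/2..1/2})"
proof (rule ennreal_le_of_power_mult_le[of "card I"])
  fix \<theta> :: real assume \<theta>: "0 < \<theta>" "\<theta> < 1"
  have [measurable]: "(\<lambda>x. \<Prod>i\<in>I. f i (form i x)) \<in> borel_measurable P"
  proof (rule borel_measurable_prod_ennreal)
    fix i assume "i \<in> I"
    from measurable_compose[OF measurable_form f(1)[OF this]]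
    show "(\<lambda>x. f i (form i x)) \<in> borel_measurable P" .
  qed
  have "ennreal (\<theta> ^ card I) * \<Phi> f = \<Phi> (\<lambda>i y. ennreal \<theta> * f i y)"
    unfolding \<Phi>_def using \<theta>
    by (subst nn_integral_cmult[symmetric]) (auto simp: prod.distrib ennreal_power)
  also have "\<dots> \<le> \<Phi> (\<lambda>i. indicator {-1/2..1/2})"
  proof (rule \<Phi>_le_of_mass_less_one[of _ \<theta>])
    fix i y assume i: "i \<in> I"
    show "(\<lambda>y. ennreal \<theta> * f i y) \<in> borel_measurable borel" using f(1)[OF i] by measurable
    have "ennreal \<theta> * f i y \<le> 1 * 1" using f(2)[OF i] \<theta> by (intro mult_mono) auto
    then show "ennreal \<theta> * f i y \<le> 1" by simp
    have "(\<integral>\<^sup>+y. ennreal \<theta> * f i y \<partial>lborel) = ennreal \<theta> * (\<integral>\<^sup>+y. f i y \<partial>lborel)"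
      using f(1)[OF i] by (intro nn_integral_cmult) auto
    also have "\<dots> \<le> ennreal \<theta> * 1" using f(3)[OF i] by (intro mult_left_mono) auto
    finally show "(\<integral>\<^sup>+y. ennreal \<theta> * f i y \<partial>lborel) \<le> ennreal \<theta>" by simp
  qed (use \<theta> in auto)
  finally show "ennreal (\<theta> ^ card I) * \<Phi> f \<le> \<Phi> (\<lambda>i. indicator {-1/2..1/2})" .
qed

end

section \<open>Random subspaces\<close>

lemma closest_point_subspace_eq:
  fixes E :: "'a :: euclidean_space set"
  assumes E: "subspace E" and p: "p \<in> E" "\<And>y. y \<in> E \<Longrightarrow> orthogonal (x - p) y"
  shows "closest_point E x = p"
proof (rule closest_point_unique[symmetric])
  show "\<forall>z\<in>E. dist x p \<le> dist x z"
  proof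
    fix z assume "z \<in> E"
    then have "orthogonal (x - p) (p - z)" using E p by (simp add: subspace_diff)
    then have "norm (x - z) ^ 2 = norm (x - p) ^ 2 + norm (p - z) ^ 2"
      using norm_add_Pythagorean[of "x - p" "p - z"] by simp
    then have "norm (x - p) ^ 2 \<le> norm (x - z) ^ 2" by simp
    then show "dist x p \<le> dist x z" by (simp add: dist_norm)
  qed
qed (use E p in \<open>auto simp: subspace_imp_convex closed_subspace\<close>)

lemma closest_point_subspace:
  fixes E :: "'a :: euclidean_space set"
  assumes E: "subspace E"
  shows "closest_point E x \<in> E" "\<And>y. y \<in> E \<Longrightarrow> orthogonal (x - closest_point E x) y"
proof -
  obtain p z where "p \<in> span E" "\<And>w. w \<in> span E \<Longrightarrow> orthogonal z w" "x = p + z"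
    using orthogonal_subspace_decomp_exists[of E x] by metis
  then have p: "p \<in> E" "\<And>y. y \<in> E \<Longrightarrow> orthogonal (x - p) y"
    using E by (auto simp: span_eq_iff[THEN iffD2])
  have "closest_point E x = p" using E p by (rule closest_point_subspace_eq)
  with p show "closest_point E x \<in> E" "\<And>y. y \<in> E \<Longrightarrow> orthogonal (x - closest_point E x) y" by auto
qed

lemma linear_closest_point_subspace:
  fixes E :: "'a :: euclidean_space set"
  assumes E: "subspace E"
  shows "linear (closest_point E)"
proof (rule linearI)
  fix x y :: 'a and c :: real
  note cp = closest_point_subspace[OF E]
  show "closest_point E (x + y) = closest_point E x + closest_point E y"
  proof (rule closest_point_subspace_eq[OF E])
    fix z assume "z \<in> E"
    then show "orthogonal (x + y - (closest_point E x + closest_point E y)) z"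
      using cp(2)[of z x] cp(2)[of z y] by (simp add: orthogonal_def inner_diff_left inner_add_left)
  qed (use E cp in \<open>simp add: subspace_add\<close>)
  show "closest_point E (c *\<^sub>R x) = c *\<^sub>R closest_point E x"
  proof (rule closest_point_subspace_eq[OF E])
    fix z assume "z \<in> E"
    then show "orthogonal (c *\<^sub>R x - c *\<^sub>R closest_point E x) z"
      using cp(2)[of z x] by (simp add: orthogonal_def inner_diff_left)
  qed (use E cp in \<open>simp add: subspace_scale\<close>)
qed

lemma projection_matrix_vector:
  fixes E :: "(real ^ 'n) set"
  assumes "subspace E"
  shows "projection_matrix E *v x = closest_point E x"
  unfolding projection_matrix_def using linear_closest_point_subspace[OF assms]
  by (rule matrix_works[OF linear_matrix_vector_mul_eq[THEN iffD2]])

lemma mem_subspace_iff_projection_matrix: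
  fixes E :: "(real ^ 'n) set"
  assumes "subspace E"
  shows "x \<in> E \<longleftrightarrow> projection_matrix E *v x = x"
  unfolding projection_matrix_vector[OF assms]
  using closest_point_subspace(1)[OF assms, of x] closest_point_subspace_eq[OF assms, of x x]
  by (auto simp: orthogonal_def)

text \<open>Conjugation by \<open>R\<close> is linear in the projection matrix, hence continuous, so
  rotations act measurably on the Grassmannian.\<close>

lemma projection_matrix_rotation:
  fixes E :: "(real ^ 'n) set"
  assumes E: "subspace E" and R: "orthogonal_matrix R"
  shows "projection_matrix ((*v) R ` E) = R ** projection_matrix E ** transpose R"
proof -
  have RE: "subspace ((*v) R ` E)" using E by (intro linear_subspace_image matrix_vector_mul_linear)
  have RR: "R *v (transpose R *v x) = x" for x
    unfolding matrix_vector_mul_assoc using R by (simp add: orthogonal_matrix_def)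
  have "projection_matrix ((*v) R ` E) *v x = (R ** projection_matrix E ** transpose R) *v x" for x
  proof -
    let ?y = "transpose R *v x"
    have "closest_point ((*v) R ` E) x = R *v closest_point E ?y"
    proof (rule closest_point_subspace_eq[OF RE])
      show "R *v closest_point E ?y \<in> (*v) R ` E" using closest_point_subspace(1)[OF E] by blast
      fix z assume "z \<in> (*v) R ` E"
      then obtain w where w: "w \<in> E" "z = R *v w" by blast
      have ot: "orthogonal_transformation ((*v) R)"
        using R by (simp add: orthogonal_transformation_matrix)
      have "orthogonal (R *v (?y - closest_point E ?y)) (R *v w)"
        using ot closest_point_subspace(2)[OF E w(1), of ?y]
        by (simp add: orthogonal_def orthogonal_transformation_def)
      then show "orthogonal (x - R *v closest_point E ?y) z"
        by (simp add: w(2) RR[simplified] matrix_vector_mult_diff_distrib)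
    qed
    then show ?thesis
      by (simp add: projection_matrix_vector[OF RE] projection_matrix_vector[OF E] flip: matrix_vector_mul_assoc)
  qed
  then show ?thesis by (simp add: matrix_eq)
qed

lemma rotation_image_grassmannian:
  fixes R :: "real ^ 'n ^ 'n"
  assumes R: "orthogonal_matrix R" and E: "E \<in> grassmannian k"
  shows "(*v) R ` E \<in> grassmannian k"
proof -
  have ot: "orthogonal_transformation ((*v) R)" using R by (simp add: orthogonal_transformation_matrix)
  then have "inj ((*v) R)" by (rule orthogonal_transformation_inj)
  then have "dim ((*v) R ` E) = dim E"
    by (intro dim_image_eq matrix_vector_mul_linear) (auto intro: inj_on_subset)
  then show ?thesis using E by (auto simp: grassmannian_def intro!: linear_subspace_image)
qed

lemma measurable_projection_matrix [measurable]:
  "projection_matrix \<in> borel_measurable (grassmannian_borel k)"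
  unfolding grassmannian_borel_def by (rule measurable_vimage_algebra1) simp

lemma space_grassmannian_borel [simp]: "space (grassmannian_borel k) = grassmannian k"
  by (simp add: grassmannian_borel_def)

lemma measurable_rotation_grassmannian:
  fixes R :: "real ^ 'n ^ 'n"
  assumes R: "orthogonal_matrix R"
  shows "(\<lambda>E. (*v) R ` E) \<in> grassmannian_borel k \<rightarrow>\<^sub>M grassmannian_borel k"
proof -
  have "linear (\<lambda>A :: real ^ 'n ^ 'n. R ** A ** transpose R)"
    by (rule linearI)
      (simp_all add: matrix_matrix_mult_def vec_eq_iff sum.distrib sum_distrib_left sum_distrib_right algebra_simps)
  then have "continuous_on UNIV (\<lambda>A :: real ^ 'n ^ 'n. R ** A ** transpose R)"
    by (intro linear_continuous_on linear_conv_bounded_linear[THEN iffD1])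
  then have [measurable]: "(\<lambda>A :: real ^ 'n ^ 'n. R ** A ** transpose R) \<in> borel_measurable borel"
    by (rule borel_measurable_continuous_onI)
  have "(\<lambda>E. R ** projection_matrix E ** transpose R) \<in> borel_measurable (grassmannian_borel k)"
    by measurable
  then have "(\<lambda>E. projection_matrix ((*v) R ` E)) \<in> borel_measurable (grassmannian_borel k)"
    by (rule measurable_cong[THEN iffD1, rotated])
      (simp add: grassmannian_def projection_matrix_rotation[OF _ R])
  moreover have "(\<lambda>E. (*v) R ` E) \<in> space (grassmannian_borel k) \<rightarrow> grassmannian k"
    using rotation_image_grassmannian[OF R] by auto
  ultimately show ?thesis
    unfolding grassmannian_borel_def[of k] by (subst (asm) (2) grassmannian_borel_def[symmetric])?
      (intro measurable_vimage_algebra2; simp add: grassmannian_borel_def)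
qed

lemma sets_subspaces_containing:
  fixes x :: "real ^ 'n"
  shows "{E \<in> grassmannian k. x \<in> E} \<in> sets (grassmannian_borel k)"
proof -
  have "linear (\<lambda>A :: real ^ 'n ^ 'n. A *v x)"
    by (rule linearI) (simp_all add: matrix_vector_mult_add_rdistrib scaleR_matrix_vector_assoc)
  then have "continuous_on UNIV (\<lambda>A :: real ^ 'n ^ 'n. A *v x)"
    by (intro linear_continuous_on linear_conv_bounded_linear[THEN iffD1])
  then have [measurable]: "(\<lambda>A :: real ^ 'n ^ 'n. A *v x) \<in> borel_measurable borel"
    by (rule borel_measurable_continuous_onI)
  have "{E \<in> space (grassmannian_borel k). projection_matrix E *v x = x} \<in> sets (grassmannian_borel k)"
    by measurable
  also have "{E \<in> space (grassmannian_borel k). projection_matrix E *v x = x} = {E \<in> grassmannian k. x \<in> E}"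
    using mem_subspace_iff_projection_matrix[of _ x] by (auto simp: grassmannian_def)
  finally show ?thesis .
qed

section \<open>Random subspaces and fixed vectors\<close>

lemma few_points_in_proper_subspaces:
  obtains q :: "nat \<Rightarrow> real ^ 'n" where "\<And>j. q j \<noteq> 0"
    "\<And>E. subspace E \<Longrightarrow> dim E < CARD('n) \<Longrightarrow> finite {j. q j \<in> E} \<and> card {j. q j \<in> E} \<le> CARD('n)"
proof -
  obtain e where e: "bij_betw e (UNIV :: 'n set) {0..<CARD('n)}"
    using ex_bij_betw_finite_nat[of "UNIV :: 'n set"] by auto
  then have inj: "inj e" and lt: "e i < CARD('n)" for i by (auto simp: bij_betw_def)
  \<comment> \<open>points of the moment curve; a hyperplane meets it in the roots of a polynomial\<close>
  define q :: "nat \<Rightarrow> real ^ 'n" where "q j = (\<chi> i. real (Suc j) ^ e i)" for j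
  show thesis
  proof (rule that[of q])
    show "q j \<noteq> 0" for j by (auto simp: q_def vec_eq_iff)
    fix E :: "(real ^ 'n) set" assume E: "subspace E" "dim E < CARD('n)"
    then obtain c where c: "c \<noteq> 0" "span E \<subseteq> {x. c \<bullet> x = 0}"
      using lowdim_subset_hyperplane[of E] by auto
    define p where "p = (\<Sum>i\<in>UNIV. monom (c $ i) (e i))"
    obtain i where i: "c $ i \<noteq> 0" using c(1) by (auto simp: vec_eq_iff)
    have "coeff p (e i) = (\<Sum>i'\<in>UNIV. if i' = i then c $ i' else 0)"
      unfolding p_def coeff_sum using inj by (intro sum.cong) (auto simp: inj_eq)
    also have "\<dots> = c $ i" by simp
    finally have "p \<noteq> 0" using i by auto
    have deg: "degree p \<le> CARD('n)"
      unfolding p_def by (intro degree_sum_le) (auto intro: order_trans[OF degree_monom_le] less_imp_le[OF lt])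
    have "poly p (real (Suc j)) = c \<bullet> q j" for j
      by (simp add: p_def poly_sum poly_monom inner_vec_def q_def)
    then have sub: "(\<lambda>j. real (Suc j)) ` {j. q j \<in> E} \<subseteq> {x. poly p x = 0}"
      using c(2) by (auto dest: span_base)
    have fin: "finite {x. poly p x = 0}" using \<open>p \<noteq> 0\<close> by (rule poly_roots_finite)
    have inj': "inj_on (\<lambda>j. real (Suc j)) {j. q j \<in> E}" by (auto simp: inj_on_def)
    have "finite {j. q j \<in> E}" using finite_subset[OF sub fin] inj' by (rule finite_imageD)
    moreover have "card {j. q j \<in> E} \<le> card {x. poly p x = 0}"
      using card_mono[OF fin sub] card_image[OF inj'] by simp
    moreover have "card {x. poly p x = 0} \<le> CARD('n)"
      using card_poly_roots_bound[OF \<open>p \<noteq> 0\<close>] deg by linarith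
    ultimately show "finite {j. q j \<in> E} \<and> card {j. q j \<in> E} \<le> CARD('n)" by auto
  qed
qed

text \<open>By invariance all nonzero vectors are contained in a random subspace with the same probability;
  a positive one would be contradicted by many points of which few lie in each subspace.\<close>

lemma haar_grassmannian_null:
  fixes x :: "real ^ 'n"
  assumes k: "1 \<le> k" "k < CARD('n)" and haar: "haar_grassmannian k \<mu>" and x: "x \<noteq> 0"
  shows "AE E in \<mu>. x \<notin> E"
proof -
  interpret prob_space \<mu> using haar by (simp add: haar_grassmannian_def)
  have sets: "sets \<mu> = sets (grassmannian_borel k)" using haar by (simp add: haar_grassmannian_def)
  have space: "space \<mu> = grassmannian k" using sets_eq_imp_space_eq[OF sets] by simp
  define U where "U y = {E \<in> grassmannian k. y \<in> E}" for y :: "real ^ 'n"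
  have U[measurable]: "U y \<in> sets \<mu>" for y unfolding U_def sets by (rule sets_subspaces_containing)
  have rot: "prob (U (R *v y)) = prob (U y)" if R: "rotation_matrix R" for R y
  proof -
    have om: "orthogonal_matrix R" using R by (simp add: rotation_matrix_def)
    have inj: "inj ((*v) R)"
      using om by (intro orthogonal_transformation_inj) (simp add: orthogonal_transformation_matrix)
    have meas: "(\<lambda>E. (*v) R ` E) \<in> \<mu> \<rightarrow>\<^sub>M \<mu>"
      using measurable_rotation_grassmannian[OF om, of k] by (simp add: measurable_cong_sets[OF sets sets])
    have "prob (U (R *v y)) = measure (distr \<mu> \<mu> (\<lambda>E. (*v) R ` E)) (U (R *v y))"
      using haar R by (simp add: haar_grassmannian_def)
    also have "\<dots> = prob ((\<lambda>E. (*v) R ` E) -` U (R *v y) \<inter> space \<mu>)"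
      by (rule measure_distr[OF meas U])
    also have "(\<lambda>E. (*v) R ` E) -` U (R *v y) \<inter> space \<mu> = U y"
      using rotation_image_grassmannian[OF om] by (auto simp: U_def space inj_image_mem_iff[OF inj])
    finally show ?thesis .
  qed
  have scale: "U (c *\<^sub>R y) = U y" if "c \<noteq> 0" for c y
  proof -
    have "c *\<^sub>R y \<in> E \<longleftrightarrow> y \<in> E" if "subspace E" for E
      using subspace_scale[OF that, of "c *\<^sub>R y" "1 / c"] subspace_scale[OF that, of y c] \<open>c \<noteq> 0\<close> by auto
    then show ?thesis by (auto simp: U_def grassmannian_def)
  qed
  have const: "prob (U y) = prob (U x)" if "y \<noteq> 0" for y
  proof -
    \<comment> \<open>Rotations act transitively on spheres only from dimension 2 on, which
      \<open>1 \<le> k\<close> and \<open>k < CARD('n)\<close> guarantee.\<close>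
    have "2 \<le> CARD('n)" using k by simp
    moreover have "norm x = norm ((norm x / norm y) *\<^sub>R y)" using that by simp
    ultimately obtain f where f: "orthogonal_transformation f" "det (matrix f) = 1" "f x = (norm x / norm y) *\<^sub>R y"
      using rotation_exists[of x "(norm x / norm y) *\<^sub>R y"] by metis
    have "rotation_matrix (matrix f)"
      using f by (simp add: rotation_matrix_def orthogonal_transformation_matrix)
    from rot[OF this, of x] have "prob (U ((norm x / norm y) *\<^sub>R y)) = prob (U x)"
      using f by (simp add: matrix_works orthogonal_transformation_linear)
    then show ?thesis using scale[of "norm x / norm y" y] x that by simp
  qed
  obtain q :: "nat \<Rightarrow> real ^ 'n" where q: "\<And>j. q j \<noteq> 0"
    "\<And>E. subspace E \<Longrightarrow> dim E < CARD('n) \<Longrightarrow> finite {j. q j \<in> E} \<and> card {j. q j \<in> E} \<le> CARD('n)"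
    using few_points_in_proper_subspaces by metis
  have int: "integrable \<mu> (indicator (U y) :: _ \<Rightarrow> real)" for y
    by (intro integrable_real_indicator U) (simp add: emeasure_eq_measure)
  \<comment> \<open>The left side is the expected number of points \<open>q j\<close>,
    \<open>j < N\<close>, in the random subspace.\<close>
  have bound: "real N * prob (U x) \<le> CARD('n)" for N
  proof -
    have "real N * prob (U x) = (\<Sum>j<N. prob (U (q j)))" using const q(1) by simp
    also have "\<dots> = (\<Sum>j<N. expectation (indicator (U (q j))))" by simp
    also have "\<dots> = expectation (\<lambda>E. \<Sum>j<N. indicator (U (q j)) E)"
      using int by (intro Bochner_Integration.integral_sum[symmetric])
    also have "\<dots> \<le> expectation (\<lambda>E. real CARD('n))"
    proof (rule integral_mono)
      fix E assume E: "E \<in> space \<mu>"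
      then have sub: "subspace E" "dim E < CARD('n)" using k by (auto simp: space grassmannian_def)
      have "(\<Sum>j<N. indicator (U (q j)) E :: real) = card {j \<in> {..<N}. E \<in> U (q j)}"
        by (simp add: indicator_def sum.If_cases Int_def)
      also have "card {j \<in> {..<N}. E \<in> U (q j)} \<le> card {j. q j \<in> E}"
        using q(2)[OF sub] by (intro card_mono) (auto simp: U_def)
      also have "\<dots> \<le> CARD('n)" using q(2)[OF sub] by simp
      finally show "(\<Sum>j<N. indicator (U (q j)) E) \<le> real CARD('n)" by simp
    qed (use int in \<open>auto intro: Bochner_Integration.integrable_sum\<close>)
    finally show ?thesis by (simp add: prob_space)
  qed
  have "prob (U x) = 0"
  proof (rule ccontr)
    assume "prob (U x) \<noteq> 0"
    then have "0 < prob (U x)" by (simp add: zero_less_measure_iff)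
    then obtain N where "real CARD('n) < real N * prob (U x)" using reals_Archimedean3 by blast
    with bound[of N] show False by simp
  qed
  then have "U x \<in> null_sets \<mu>" by (simp add: null_sets_def emeasure_eq_measure)
  then show ?thesis
    by (rule AE_I') (auto simp: U_def space)
qed

section \<open>Marginal densities\<close>

text \<open>A density is only Lebesgue measurable and bounded almost everywhere, whereas the
  functional wants Borel factors bounded everywhere. The exceptional set is collected in a Borel
  null set \<open>N\<close>, so that its preimage under a coordinate form is measurable and
  null.\<close>

lemma bounded_density_borel_version:
  assumes "bounded_density g"
  obtains G N where "G \<in> borel_measurable borel" "\<And>t. G t \<le> 1" "(\<integral>\<^sup>+t. G t \<partial>lborel) = 1"
    "N \<in> null_sets lborel" "\<And>t. t \<notin> N \<Longrightarrow> ennreal (g t) = G t"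
proof -
  have [measurable]: "g \<in> borel_measurable lebesgue" and ess: "esssup lebesgue (\<lambda>t. ennreal (g t)) \<le> 1"
    and int: "(\<integral>\<^sup>+t. ennreal (g t) \<partial>lebesgue) = 1"
    using assms by (auto simp: bounded_density_def)
  have "(\<lambda>t. ennreal (g t)) \<in> borel_measurable (completion lborel)" by measurable
  then obtain g' where g': "g' \<in> borel_measurable lborel" "AE t in lborel. ennreal (g t) = g' t"
    using completion_ex_borel_measurable by metis
  have [measurable]: "g' \<in> borel_measurable borel" using g' by simp
  have "AE t in lebesgue. ennreal (g t) \<le> 1"
    using esssup_AE[of "\<lambda>t. ennreal (g t)" lebesgue]
    by (rule eventually_mono) (rule order_trans[OF _ ess])
  then have "AE t in lborel. ennreal (g t) \<le> 1" by (simp add: AE_completion_iff)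
  with g'(2) have ae: "AE t in lborel. ennreal (g t) = min 1 (g' t)" by eventually_elim (simp add: min_absorb2)
  obtain N where N: "N \<in> null_sets lborel" "{t\<in>space lborel. ennreal (g t) \<noteq> min 1 (g' t)} \<subseteq> N"
    using ae unfolding eventually_ae_filter by blast
  show thesis
  proof (rule that[of "\<lambda>t. min 1 (g' t)" N])
    have "(\<integral>\<^sup>+t. min 1 (g' t) \<partial>lborel) = (\<integral>\<^sup>+t. min 1 (g' t) \<partial>lebesgue)"
      by (rule nn_integral_completion[symmetric])
    also have "\<dots> = (\<integral>\<^sup>+t. ennreal (g t) \<partial>lebesgue)"
      using ae by (intro nn_integral_cong_AE) (auto simp: AE_completion_iff)
    finally show "(\<integral>\<^sup>+t. min 1 (g' t) \<partial>lborel) = 1" using int by simp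
  qed (use N in auto)
qed

lemma orthonormal_basis_of_some:
  fixes V :: "(real ^ 'n) set"
  assumes "subspace V"
  defines "B \<equiv> (SOME B. orthonormal_basis_of V B)"
  shows "finite B" "span B = V"
proof -
  obtain B' where "B' \<subseteq> V" "pairwise orthogonal B'" "\<And>x. x \<in> B' \<Longrightarrow> norm x = 1" "span B' = V"
    using orthonormal_basis_subspace[OF assms(1)] by metis
  then have "orthonormal_basis_of V B'" by (simp add: orthonormal_basis_of_def)
  then have B: "orthonormal_basis_of V B" unfolding B_def by (rule someI)
  then have "independent B"
    by (intro pairwise_orthogonal_independent) (auto simp: orthonormal_basis_of_def)
  then show "finite B" by (rule independent_imp_finite)
  show "span B = V" using B by (simp add: orthonormal_basis_of_def)
qed

text \<open>If \<open>E\<close> contained a coordinate vector, the corresponding coordinate would vanish on the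
  orthogonal complement and \<open>f\<close> would be evaluated there at a point where the essential bound says
  nothing.\<close>

lemma marginal_density_le_cube:
  fixes f :: "real ^ 'n \<Rightarrow> real"
  assumes E: "subspace E" "\<And>i. axis i 1 \<notin> E" and f: "f \<in> product_densities"
  shows "marginal_density E f 0 \<le> marginal_density E (indicator centered_unit_cube) 0"
proof -
  obtain g where g: "\<And>i. bounded_density (g i)" "f = (\<lambda>x. \<Prod>i\<in>UNIV. g i (x $ i))"
    using f by (auto simp: product_densities_def)
  define B where "B = (SOME B. orthonormal_basis_of (E\<^sup>\<bottom>) B)"
  have B: "finite B" "span B = E\<^sup>\<bottom>"
    unfolding B_def by (rule orthonormal_basis_of_some[OF subspace_orthogonal_comp])+
  interpret linear_forms B "UNIV :: 'n set" "\<lambda>i b. b $ i"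
  proof
    fix i :: 'n
    show "\<exists>b\<in>B. b $ i \<noteq> 0"
    proof (rule ccontr)
      assume "\<not> (\<exists>b\<in>B. b $ i \<noteq> 0)"
      then have "B \<subseteq> {x. axis i 1 \<bullet> x = 0}" by (auto simp: inner_axis')
      then have "span B \<subseteq> {x. axis i 1 \<bullet> x = 0}" by (rule span_minimal) (rule subspace_hyperplane)
      then have "axis i 1 \<in> E\<^sup>\<bottom>\<^sup>\<bottom>"
        unfolding B(2) by (auto simp: orthogonal_comp_def orthogonal_def inner_commute)
      with E show False by (simp add: orthogonal_comp_self)
    qed
  qed (use B in auto)
  \<comment> \<open>The point of the orthogonal complement with coefficients \<open>c\<close>; the
    summand 0 is the base point in \<open>affine_lebesgue\<close>.\<close>
  define T where "T c = (\<Sum>b\<in>B. c b *\<^sub>R b) + 0" for c :: "real ^ 'n \<Rightarrow> real"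
  have T[measurable]: "T \<in> P \<rightarrow>\<^sub>M borel" unfolding T_def[abs_def] P_def by measurable
  have T_nth: "T c $ i = form i c" for c i by (simp add: T_def form_def mult.commute)
  \<comment> \<open>Stated up to null sets \<open>N i\<close> to serve both sides: for
    \<open>f\<close> they are the exceptional sets of the densities, for the cube they are
    empty.\<close>
  have marginal: "marginal_density E h 0 = \<Phi> H"
    if H: "\<And>i. H i \<in> borel_measurable borel" and N: "\<And>i. N i \<in> null_sets lborel"
      and h: "\<And>y. (\<forall>i. y $ i \<notin> N i) \<Longrightarrow> ennreal (h y) = (\<Prod>i\<in>UNIV. H i (y $ i))"
    for h :: "real ^ 'n \<Rightarrow> real" and H N
  proof -
    note [measurable] = H
    have [measurable]: "N i \<in> sets borel" for i using N[of i] by auto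
    have "AE c in P. \<forall>i\<in>UNIV. form i c \<notin> N i"
      using AE_form_notin_null_set[OF _ N] by (subst AE_finite_all) auto
    then have "AE y in distr P borel T. \<forall>i. y $ i \<notin> N i"
      by (subst AE_distr_iff) (auto simp: T_nth)
    then have ae: "AE y in distr P borel T. ennreal (h y) = (\<Prod>i\<in>UNIV. H i (y $ i))"
      by eventually_elim (rule h)
    have "marginal_density E h 0 = (\<integral>\<^sup>+y. ennreal (h y) \<partial>completion (distr P borel T))"
      by (simp add: marginal_density_def affine_lebesgue_def Let_def P_def T_def[abs_def] flip: B_def)
    also have "\<dots> = (\<integral>\<^sup>+y. ennreal (h y) \<partial>distr P borel T)" by (rule nn_integral_completion)
    also have "\<dots> = (\<integral>\<^sup>+y. (\<Prod>i\<in>UNIV. H i (y $ i)) \<partial>distr P borel T)" by (rule nn_integral_cong_AE[OF ae])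
    also have "\<dots> = (\<integral>\<^sup>+c. (\<Prod>i\<in>UNIV. H i (T c $ i)) \<partial>P)" by (rule nn_integral_distr) measurable
    finally show ?thesis by (simp add: \<Phi>_def T_nth)
  qed
  have "\<exists>G N. G \<in> borel_measurable borel \<and> (\<forall>t. G t \<le> 1) \<and> (\<integral>\<^sup>+t. G t \<partial>lborel) = 1 \<and>
      N \<in> null_sets lborel \<and> (\<forall>t. t \<notin> N \<longrightarrow> ennreal (g i t) = G t)" for i
    using bounded_density_borel_version[OF g(1)[of i]] by metis
  then obtain G N where G: "\<And>i. G i \<in> borel_measurable borel" "\<And>i t. G i t \<le> 1"
      "\<And>i. (\<integral>\<^sup>+t. G i t \<partial>lborel) = 1" "\<And>i. N i \<in> null_sets lborel" "\<And>i t. t \<notin> N i \<Longrightarrow> ennreal (g i t) = G i t"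
    by metis
  have nonneg: "0 \<le> g i t" for i t using g(1)[of i] by (simp add: bounded_density_def)
  have "marginal_density E f 0 = \<Phi> G"
    using G(5) nonneg by (intro marginal[where N = N] G) (simp add: g(2) flip: prod_ennreal)
  also have "\<dots> \<le> \<Phi> (\<lambda>i. indicator {-1/2..1/2})"
    using G by (intro \<Phi>_le_cube) auto
  also have "\<dots> = marginal_density E (indicator centered_unit_cube) 0"
  proof (rule marginal[where N = "\<lambda>_. {}", symmetric])
    fix y :: "real ^ 'n"
    show "ennreal (indicator centered_unit_cube y) = (\<Prod>i\<in>UNIV. indicator {-1/2..1/2} (y $ i))"
    proof (cases "y \<in> centered_unit_cube")
      case True
      then show ?thesis by (simp add: centered_unit_cube_def)
    next
      case False
      then obtain i where "y $ i \<notin> {-1/2..1/2}" unfolding centered_unit_cube_def by blast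
      then have "indicator {-1/2..1/2} (y $ i) = (0 :: ennreal)" by (rule indicator_simps(2))
      then have "(\<Prod>i\<in>UNIV. indicator {-1/2..1/2} (y $ i)) = (0 :: ennreal)"
        by (intro prod_zero finite bexI[of _ i] UNIV_I)
      with False show ?thesis by simp
    qed
  qed auto
  finally show ?thesis .
qed

theorem proposition1p2:
  fixes f :: "real ^ 'n \<Rightarrow> real"
    and k :: nat
    and \<mu> :: "(real ^ 'n) set measure"
  assumes "1 \<le> k" and "k < CARD('n)"
    and "haar_grassmannian k \<mu>"
    and "f \<in> product_densities"
  shows "(\<integral>\<^sup>+ E. marginal_density E f 0 ^ CARD('n) \<partial>\<mu>)
       \<le> (\<integral>\<^sup>+ E. marginal_density E (indicator centered_unit_cube) 0 ^ CARD('n) \<partial>\<mu>)"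
proof (rule nn_integral_mono_AE)
  have "space \<mu> = grassmannian k"
    using assms(3) sets_eq_imp_space_eq[of \<mu>] by (auto simp: haar_grassmannian_def)
  then have "AE E in \<mu>. subspace E" by (auto simp: grassmannian_def)
  moreover have "AE E in \<mu>. \<forall>i\<in>UNIV. axis i 1 \<notin> E"
    using haar_grassmannian_null[OF assms(1-3)] by (subst AE_finite_all) auto
  ultimately show "AE E in \<mu>. marginal_density E f 0 ^ CARD('n)
      \<le> marginal_density E (indicator centered_unit_cube) 0 ^ CARD('n)"
    by eventually_elim (auto intro!: power_mono_ennreal marginal_density_le_cube assms(4))
qed

end
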